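(* Let $\mathcal P(\boldsymbol\alpha,\boldsymbol\ell)$ be a curvilinear polygon with $n$ vertices. Then $\sigma\ge0$ is a quasi-eigenvalue of $\mathcal P$ if and only if $F^{\mathcal P}(\boldsymbol\alpha,\boldsymbol\ell,\sigma)=0$, where $$F^{\mathcal P}(\boldsymbol\alpha,\boldsymbol\ell,\sigma)=\sum_{\substack{\boldsymbol\zeta\in\{\pm1\}^n\\ \zeta_1=1}}\mathfrak p_{\boldsymbol\zeta}(\boldsymbol\alpha)\cos(\boldsymbol\ell\cdot\boldsymbol\zeta\,\sigma)-\prod_{j=1}^n\sin\Big(\frac{\pi^2}{2\alpha_j}\Big).$$ Moreover, the multiplicity of a quasi-eigenvalue $\sigma>0$ equals its multiplicity as a root of $F^{\mathcal P}(\boldsymbol\alpha,\boldsymbol\ell,\cdot)$, and the multiplicity of the quasi-eigenvalue $\sigma=0$ equals half its multiplicity as a root of $F^{\mathcal P}(\boldsymbol\alpha,\boldsymbol\ell,\cdot)$.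
   Context: For $\boldsymbol\zeta=(\zeta_1,\dots,\zeta_n)\in\{\pm1\}^n$ with cyclic convention $\zeta_{n+1}=\zeta_1$, let $\mathrm{ch}(\boldsymbol\zeta)=\{j\in\{1,\dots,n\}:\zeta_j\ne\zeta_{j+1}\}$ and $\mathfrak p_{\boldsymbol\zeta}(\boldsymbol\alpha)=\prod_{j\in\mathrm{ch}(\boldsymbol\zeta)}\cos(\pi^2/(2\alpha_j))$ (empty product $=1$); $\boldsymbol\ell\cdot\boldsymbol\zeta=\sum_j\ell_j\zeta_j$. A curvilinear polygon $\mathcal P(\boldsymbol\alpha,\boldsymbol\ell)$: bounded simply connected planar domain with boundary a closed non-self-intersecting curve of $n$ smooth arcs $I_1,\dots,I_n$, vertices $V_1,\dots,V_n$ clockwise (cyclic indices), $I_j$ joins $V_{j-1},V_j$, length $\ell_j>0$, interior angle $\alpha_j\in(0,\pi)$ at $V_j$. $\mathcal E=\{\pi/(2k):k\in\mathbb N\}$, $\mathcal O(\pi/(2k))=(-1)^k$. For $\alpha\notin\mathcal E$, $\mathtt A(\alpha)=\begin{pmatrix}\csc\frac{\pi^2}{2\alpha}&-i\cot\frac{\pi^2}{2\alpha}\\ i\cot\frac{\pi^2}{2\alpha}&\csc\frac{\pi^2}{2\alpha}\end{pmatrix}$; $\mathtt B(\ell,\sigma)=\operatorname{diag}(e^{i\ell\sigma},e^{-i\ell\sigma})$. Quasi-eigenvalues: if no angle is in $\mathcal E$, $\sigma\ge0$ is a quasi-eigenvalue iff $1$ is an eigenvalue of $\mathtt T(\sigma)=\mathtt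 A(\alpha_n)\mathtt B(\ell_n,\sigma)\cdots\mathtt A(\alpha_1)\mathtt B(\ell_1,\sigma)$; multiplicity of $\sigma>0$ is the geometric multiplicity of that eigenvalue, multiplicity of $0$ is $1$. Otherwise, with exceptional vertices $V_{E_1},\dots,V_{E_K}$, $1\le E_1<\dots<E_K=n$, $E_0:=E_K$, set $\mathtt U_\kappa(\sigma)=\mathtt B(\ell_{E_\kappa},\sigma)\mathtt A(\alpha_{E_\kappa-1})\mathtt B(\ell_{E_\kappa-1},\sigma)\cdots\mathtt A(\alpha_{E_{\kappa-1}+1})\mathtt B(\ell_{E_{\kappa-1}+1},\sigma)$ (indices mod $n$), $\mathbf X_{\rm even}=\frac1{\sqrt2}(e^{-i\pi/4},e^{i\pi/4})^T$, $\mathbf X_{\rm odd}=\frac1{\sqrt2}(e^{i\pi/4},e^{-i\pi/4})^T$, $\mathbf X(\alpha)=\mathbf X_{\rm even}$ if $\mathcal O(\alpha)=1$, else $\mathbf X_{\rm odd}$; $u\cdot v=u_1\bar v_1+u_2\bar v_2$. Then $\sigma\ge0$ is a quasi-eigenvalue iff $\mathtt U_\kappa(\sigma)\mathbf X(\alpha_{E_{\kappa-1}})\cdot\mathbf X(\alpha_{E_\kappa})=0$ for some $\kappa$; multiplicity of $\sigma>0$ is the number of such $\kappa$, and of $\sigma=0$ is half the number of $\kappa$ with $\mathcal O(\alpha_{E_{\kappa-1}})\neq\mathcal O(\alpha_{E_\kappa})$. *)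

theory Defs
  imports Complex_Main "HOL-Analysis.Derivative" "HOL-Library.FuncSet" "Jordan_Normal_Form.Jordan_Normal_Form_Uniqueness"
begin

(* Vertices / arcs are indexed by 1..n; alpha, ell :: nat => real are only used on 1..n. *)

definition cidx :: "nat \<Rightarrow> nat \<Rightarrow> nat" where
  "cidx n j = (j - 1) mod n + 1"

definition signvecs :: "nat \<Rightarrow> (nat \<Rightarrow> real) set" where
  "signvecs n = Pi\<^sub>E {1..n} (\<lambda>_. {-1, 1})"

definition changes :: "nat \<Rightarrow> (nat \<Rightarrow> real) \<Rightarrow> nat set" where
  "changes n \<zeta> = {j \<in> {1..n}. \<zeta> j \<noteq> \<zeta> (cidx n (j + 1))}"

definition pfrak :: "nat \<Rightarrow> (nat \<Rightarrow> real) \<Rightarrow> (nat \<Rightarrow> real) \<Rightarrow> real" where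
  "pfrak n \<zeta> \<alpha> = (\<Prod>j\<in>changes n \<zeta>. cos (pi\<^sup>2 / (2 * \<alpha> j)))"

definition FP :: "nat \<Rightarrow> (nat \<Rightarrow> real) \<Rightarrow> (nat \<Rightarrow> real) \<Rightarrow> real \<Rightarrow> real" where
  "FP n \<alpha> ell \<sigma> =
     (\<Sum>\<zeta>\<in>{\<zeta> \<in> signvecs n. \<zeta> 1 = 1}. pfrak n \<zeta> \<alpha> * cos ((\<Sum>j=1..n. ell j * \<zeta> j) * \<sigma>))
     - (\<Prod>j=1..n. sin (pi\<^sup>2 / (2 * \<alpha> j)))"

definition root_mult :: "(real \<Rightarrow> real) \<Rightarrow> real \<Rightarrow> nat" where
  "root_mult f x = (LEAST k. (deriv ^^ k) f x \<noteq> 0)"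

definition exceptional :: "real \<Rightarrow> bool" where
  "exceptional a \<longleftrightarrow> (\<exists>k::nat. k \<ge> 1 \<and> a = pi / (2 * real k))"

definition parity_O :: "real \<Rightarrow> int" where
  "parity_O a = (-1) ^ (THE k::nat. k \<ge> 1 \<and> a = pi / (2 * real k))"

definition matA :: "real \<Rightarrow> complex mat" where
  "matA a = (let t = pi\<^sup>2 / (2 * a) in
     mat_of_rows_list 2 [[complex_of_real (1 / sin t), - \<i> * complex_of_real (cot t)],
                         [\<i> * complex_of_real (cot t), complex_of_real (1 / sin t)]])"

definition matB :: "real \<Rightarrow> real \<Rightarrow> complex mat" where
  "matB l \<sigma> = mat_of_rows_list 2 [[cis (l * \<sigma>), 0], [0, cis (- (l * \<sigma>))]]"

fun Tprod :: "(nat \<Rightarrow> real) \<Rightarrow> (nat \<Rightarrow> real) \<Rightarrow> real \<Rightarrow> nat \<Rightarrow> complex mat" where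
  "Tprod \<alpha> ell \<sigma> 0 = 1\<^sub>m 2"
| "Tprod \<alpha> ell \<sigma> (Suc k) = matA (\<alpha> (Suc k)) * matB (ell (Suc k)) \<sigma> * Tprod \<alpha> ell \<sigma> k"

definition matT :: "nat \<Rightarrow> (nat \<Rightarrow> real) \<Rightarrow> (nat \<Rightarrow> real) \<Rightarrow> real \<Rightarrow> complex mat" where
  "matT n \<alpha> ell \<sigma> = Tprod \<alpha> ell \<sigma> n"

definition exc_set :: "nat \<Rightarrow> (nat \<Rightarrow> real) \<Rightarrow> nat set" where
  "exc_set n \<alpha> = {j \<in> {1..n}. exceptional (\<alpha> j)}"

(* for an exceptional vertex e: number of arcs back to the previous exceptional vertex
   (cyclically; equals n if e is the only exceptional vertex) *)
definition gap :: "nat \<Rightarrow> (nat \<Rightarrow> real) \<Rightarrow> nat \<Rightarrow> nat" where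
  "gap n \<alpha> e = (LEAST k. 1 \<le> k \<and> cidx n (e + n - k) \<in> exc_set n \<alpha>)"

definition prev_exc :: "nat \<Rightarrow> (nat \<Rightarrow> real) \<Rightarrow> nat \<Rightarrow> nat" where
  "prev_exc n \<alpha> e = cidx n (e + n - gap n \<alpha> e)"

fun Uprod :: "nat \<Rightarrow> (nat \<Rightarrow> real) \<Rightarrow> (nat \<Rightarrow> real) \<Rightarrow> real \<Rightarrow> nat \<Rightarrow> nat \<Rightarrow> complex mat" where
  "Uprod n \<alpha> ell \<sigma> p 0 = 1\<^sub>m 2"
| "Uprod n \<alpha> ell \<sigma> p (Suc 0) = matB (ell (cidx n (p + 1))) \<sigma>"
| "Uprod n \<alpha> ell \<sigma> p (Suc (Suc t)) =
     matB (ell (cidx n (p + Suc (Suc t)))) \<sigma> * matA (\<alpha> (cidx n (p + Suc t))) * Uprod n \<alpha> ell \<sigma> p (Suc t)"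

(* U_kappa for the exceptional vertex e = E_kappa (then E_(kappa-1) = prev_exc e) *)
definition matU :: "nat \<Rightarrow> (nat \<Rightarrow> real) \<Rightarrow> (nat \<Rightarrow> real) \<Rightarrow> real \<Rightarrow> nat \<Rightarrow> complex mat" where
  "matU n \<alpha> ell \<sigma> e = Uprod n \<alpha> ell \<sigma> (prev_exc n \<alpha> e) (gap n \<alpha> e)"

definition X_even :: "complex vec" where
  "X_even = vec_of_list [cis (- pi / 4) / sqrt 2, cis (pi / 4) / sqrt 2]"

definition X_odd :: "complex vec" where
  "X_odd = vec_of_list [cis (pi / 4) / sqrt 2, cis (- pi / 4) / sqrt 2]"

definition Xvec :: "real \<Rightarrow> complex vec" where
  "Xvec a = (if parity_O a = 1 then X_even else X_odd)"

definition herm_dot :: "complex vec \<Rightarrow> complex vec \<Rightarrow> complex" where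
  "herm_dot u v = u $ 0 * cnj (v $ 0) + u $ 1 * cnj (v $ 1)"

definition good_exc :: "nat \<Rightarrow> (nat \<Rightarrow> real) \<Rightarrow> (nat \<Rightarrow> real) \<Rightarrow> real \<Rightarrow> nat set" where
  "good_exc n \<alpha> ell \<sigma> = {e \<in> exc_set n \<alpha>.
      herm_dot (matU n \<alpha> ell \<sigma> e *\<^sub>v Xvec (\<alpha> (prev_exc n \<alpha> e))) (Xvec (\<alpha> e)) = 0}"

definition quasi_eigenvalue :: "nat \<Rightarrow> (nat \<Rightarrow> real) \<Rightarrow> (nat \<Rightarrow> real) \<Rightarrow> real \<Rightarrow> bool" where
  "quasi_eigenvalue n \<alpha> ell \<sigma> \<longleftrightarrow> \<sigma> \<ge> 0 \<and>
     (if exc_set n \<alpha> = {} then eigenvalue (matT n \<alpha> ell \<sigma>) 1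
      else good_exc n \<alpha> ell \<sigma> \<noteq> {})"

(* multiplicity (a real number because of the "half" in the sigma = 0 exceptional case) *)
definition qe_mult :: "nat \<Rightarrow> (nat \<Rightarrow> real) \<Rightarrow> (nat \<Rightarrow> real) \<Rightarrow> real \<Rightarrow> real" where
  "qe_mult n \<alpha> ell \<sigma> =
     (if exc_set n \<alpha> = {} then
        (if \<sigma> = 0 then 1 else real (dim_gen_eigenspace (matT n \<alpha> ell \<sigma>) 1 1))
      else
        (if \<sigma> = 0 then real (card {e \<in> exc_set n \<alpha>.
                                  parity_O (\<alpha> (prev_exc n \<alpha> e)) \<noteq> parity_O (\<alpha> e)}) / 2
         else real (card (good_exc n \<alpha> ell \<sigma>))))"

end

theory Submission
  imports Defs "HOL-Computational_Algebra.Formal_Power_Series"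
begin

text \<open>
  The matrices \<open>matA\<close> and \<open>matB\<close> are real-linear maps \<open>z \<mapsto> a z + b (cnj z)\<close> of determinant
  \<open>\<bar>a\<bar>\<^sup>2 - \<bar>b\<bar>\<^sup>2 = 1\<close>, written as pairs \<open>(a, b)\<close>. Clearing the denominators \<open>sin (pi\<^sup>2 / (2 \<alpha>\<^sub>j))\<close> and
  expanding the trace of the cyclic product over all sign vectors shows that \<open>F\<close> is half that trace
  minus the product of the sines.

  Without exceptional angles \<open>F\<close> is thus a nonzero multiple of \<open>tr T / 2 - 1\<close>, which vanishes iff
  \<open>1\<close> is an eigenvalue of \<open>T\<close>, as \<open>det T = 1\<close>. The logarithmic derivative of \<open>T\<close> corresponds to a
  positive definite Hermitian matrix; hence \<open>F'\<close> vanishes at a root only if \<open>T = 1\<close>, and then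
  \<open>F'' \<noteq> 0\<close>. At \<open>\<sigma> = 0\<close> trace \<open>2\<close> forces \<open>T = 1\<close>.

  At an exceptional angle the cleared matrix has rank one, so the trace splits into a product over
  the exceptional vertices of the functions defining the quasi-eigenvalues. Each of these has only simple
  zeros because the solution vector rotates strictly counterclockwise as \<open>\<sigma>\<close> grows.
\<close>

section \<open>Real-linear maps of the complex plane\<close>

fun rcomp :: "complex \<times> complex \<Rightarrow> complex \<times> complex \<Rightarrow> complex \<times> complex" (infixl \<open>\<star>\<close> 70) where
  "(a, b) \<star> (c, d) = (a * c + b * cnj d, a * d + b * cnj c)"

fun ract :: "complex \<times> complex \<Rightarrow> complex \<Rightarrow> complex" where
  "ract (a, b) z = a * z + b * cnj z"

text \<open>The matrix of the map in the coordinates \<open>(z, cnj z)\<close>. \<open>matA\<close>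
  and \<open>matB\<close> have this conjugate-symmetric form, hence so do their products, and trace
  and determinant are real.\<close>

definition rmat :: "complex \<times> complex \<Rightarrow> complex mat" where
  "rmat p = mat_of_rows_list 2 [[fst p, snd p], [cnj (snd p), cnj (fst p)]]"

definition rtr :: "complex \<times> complex \<Rightarrow> real" where
  "rtr p = 2 * Re (fst p)"

definition rdet :: "complex \<times> complex \<Rightarrow> real" where
  "rdet p = (cmod (fst p))\<^sup>2 - (cmod (snd p))\<^sup>2"

definition rA :: "real \<Rightarrow> complex \<times> complex" where
  "rA a = (let t = pi\<^sup>2 / (2 * a) in (complex_of_real (1 / sin t), - \<i> * complex_of_real (cot t)))"

definition rB :: "real \<Rightarrow> real \<Rightarrow> complex \<times> complex" where
  "rB l \<sigma> = (cis (l * \<sigma>), 0)"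

text \<open>\<open>rA a\<close> with its denominator cleared; it stays meaningful where the sine
  vanishes, that is, at exceptional angles.\<close>

definition rN :: "real \<Rightarrow> complex \<times> complex" where
  "rN a = (1, - \<i> * complex_of_real (cos (pi\<^sup>2 / (2 * a))))"

text \<open>Ordered product over the vertices \<open>p + 1\<close> to \<open>p + k\<close>, newest
  factor on the left. The start \<open>p\<close> is free so that a closed product can be cut at any
  vertex.\<close>

fun seg :: "(nat \<Rightarrow> complex \<times> complex) \<Rightarrow> nat \<Rightarrow> nat \<Rightarrow> complex \<times> complex" where
  "seg M p 0 = (1, 0)"
| "seg M p (Suc k) = M (p + Suc k) \<star> seg M p k"

lemma rcomp_assoc: "(p \<star> q) \<star> r = p \<star> (q \<star> r)"
  by (cases p; cases q; cases r) (simp add: algebra_simps)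

lemma rcomp_one [simp]: "(1, 0) \<star> p = p" "p \<star> (1, 0) = p"
  by (cases p; simp)+

lemma rcomp_scaleR: "(r *\<^sub>R p) \<star> q = r *\<^sub>R (p \<star> q)" "p \<star> (r *\<^sub>R q) = r *\<^sub>R (p \<star> q)"
  by (cases p; cases q; simp add: algebra_simps)+

lemma ract_rcomp: "ract (p \<star> q) z = ract p (ract q z)"
  by (cases p; cases q) (simp add: algebra_simps)

lemma ract_one [simp]: "ract (1, 0) z = z"
  by simp

lemma ract_scaleR: "ract (r *\<^sub>R p) z = of_real r * ract p z"
  by (cases p) (simp add: algebra_simps scaleR_conv_of_real)

lemma ract_real_mult: "ract p (of_real r * z) = of_real r * ract p z"
  by (cases p) (simp add: algebra_simps)

lemma rtr_commute: "rtr (p \<star> q) = rtr (q \<star> p)"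
  by (cases p; cases q) (simp add: rtr_def algebra_simps)

lemma rtr_scaleR: "rtr (r *\<^sub>R p) = r * rtr p"
  by (simp add: rtr_def)

lemma rdet_rcomp: "rdet (p \<star> q) = rdet p * rdet q"
proof -
  obtain a b c d where [simp]: "p = (a, b)" "q = (c, d)" by (metis surj_pair)
  show ?thesis
    unfolding rdet_def cmod_power2 by (simp add: power2_eq_square algebra_simps)
qed

lemma seg_add: "seg M p (k + l) = seg M (p + k) l \<star> seg M p k"
  by (induction l) (simp_all add: rcomp_assoc add.assoc)

lemma seg_cong: "(\<And>j. 1 \<le> j \<Longrightarrow> j \<le> k \<Longrightarrow> M (p + j) = M' (q + j)) \<Longrightarrow> seg M p k = seg M' q k"
  by (induction k) (auto simp del: add_Suc_right)

section \<open>Pairs as two-by-two matrices, and their eigenvalue 1\<close>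

lemma sum_upto_2: "sum f {0..<2::nat} = f 0 + f (Suc 0)"
  by (simp add: numeral_2_eq_2)

lemma mat2_eqI:
  assumes "A \<in> carrier_mat 2 2" "B \<in> carrier_mat 2 2"
    and "A $$ (0, 0) = B $$ (0, 0)" "A $$ (0, Suc 0) = B $$ (0, Suc 0)"
    and "A $$ (Suc 0, 0) = B $$ (Suc 0, 0)" "A $$ (Suc 0, Suc 0) = B $$ (Suc 0, Suc 0)"
  shows "A = B"
proof (rule eq_matI)
  fix i j assume "i < dim_row B" "j < dim_col B"
  then have "(i = 0 \<or> i = Suc 0) \<and> (j = 0 \<or> j = Suc 0)" using assms(2) by auto
  then show "A $$ (i, j) = B $$ (i, j)" using assms by auto
qed (use assms in auto)

lemma mat2_carrier [simp]: "mat_of_rows_list 2 [[a, b], [c, d]] \<in> carrier_mat 2 2"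
  by (simp add: mat_of_rows_list_def numeral_2_eq_2)

lemma mat2_index [simp]:
  "mat_of_rows_list 2 [[a, b], [c, d]] $$ (0, 0) = a"
  "mat_of_rows_list 2 [[a, b], [c, d]] $$ (0, Suc 0) = b"
  "mat_of_rows_list 2 [[a, b], [c, d]] $$ (Suc 0, 0) = c"
  "mat_of_rows_list 2 [[a, b], [c, d]] $$ (Suc 0, Suc 0) = d"
  by (simp_all add: mat_of_rows_list_def)

lemma mat2_dim [simp]:
  "dim_row (mat_of_rows_list 2 [[a, b], [c, d]]) = 2"
  "dim_col (mat_of_rows_list 2 [[a, b], [c, d]]) = 2"
  by (simp_all add: mat_of_rows_list_def)

lemma mat2_mult:
  "mat_of_rows_list 2 [[a, b], [c, d]] * mat_of_rows_list 2 [[a', b'], [c', d']] =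
   mat_of_rows_list 2 [[a * a' + b * c', a * b' + b * d'], [c * a' + d * c', c * b' + d * d' :: complex]]"
proof (rule mat2_eqI)
  show "mat_of_rows_list 2 [[a, b], [c, d]] * mat_of_rows_list 2 [[a', b'], [c', d']] \<in> carrier_mat 2 2"
    by (rule mult_carrier_mat) auto
qed (simp_all add: scalar_prod_def sum_upto_2)

lemma mat2_one: "1\<^sub>m 2 = mat_of_rows_list 2 [[1, 0], [0, 1]]"
  by (rule mat2_eqI) auto

lemma rmat_carrier [simp]: "rmat p \<in> carrier_mat 2 2"
  by (simp add: rmat_def)

lemma rmat_dim [simp]: "dim_row (rmat p) = 2" "dim_col (rmat p) = 2"
  by (simp_all add: rmat_def)

lemma rmat_mult: "rmat p * rmat q = rmat (p \<star> q)"
  by (cases p; cases q) (simp add: rmat_def mat2_mult mult.commute add.commute)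

lemma rmat_one: "rmat (1, 0) = 1\<^sub>m 2"
  by (simp add: rmat_def mat2_one)

lemma rmat_rA: "matA a = rmat (rA a)"
  by (simp add: rmat_def matA_def rA_def Let_def rmat_def)

lemma rmat_rB: "matB l \<sigma> = rmat (rB l \<sigma>)"
  by (simp add: rmat_def matB_def rB_def cis_cnj)

lemma rdet_rA:
  assumes "sin (pi\<^sup>2 / (2 * a)) \<noteq> 0"
  shows "rdet (rA a) = 1"
proof -
  define t where "t = pi\<^sup>2 / (2 * a)"
  have "sin t \<noteq> 0" using assms t_def by simp
  then have "(1 / sin t)\<^sup>2 - (cot t)\<^sup>2 = 1"
    using sin_cos_squared_add[of t] by (simp add: cot_def field_simps)
  then show ?thesis unfolding rdet_def rA_def Let_def t_def[symmetric]
    by (simp add: norm_mult norm_divide power_divide power2_abs)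
qed

lemma rdet_rB: "rdet (rB l \<sigma>) = 1"
  by (simp add: rdet_def rB_def)

lemma rN_eq:
  assumes "sin (pi\<^sup>2 / (2 * a)) \<noteq> 0"
  shows "rN a = sin (pi\<^sup>2 / (2 * a)) *\<^sub>R rA a"
  using assms by (simp add: rN_def rA_def Let_def cot_def scaleR_conv_of_real)

lemma Tprod_eq_rmat: "Tprod \<alpha> ell \<sigma> k = rmat (seg (\<lambda>j. rA (\<alpha> j) \<star> rB (ell j) \<sigma>) 0 k)"
  by (induction k) (simp_all add: rmat_one rmat_rA rmat_rB rmat_mult)

text \<open>The right-hand side is the characteristic polynomial at 1; \<open>eq\<close> rewrites it
  as the determinant of \<open>rmat p - 1\<close>, and solvability is then checked in
  coordinates.\<close>

lemma eigenvalue_rmat_one: "eigenvalue (rmat p) 1 \<longleftrightarrow> rdet p - rtr p + 1 = 0"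
proof -
  obtain a b where p: "p = (a, b)" by fastforce
  have eq: "of_real (rdet p - rtr p + 1) = (a - 1) * (cnj a - 1) - b * cnj b"
    unfolding p rdet_def rtr_def cmod_power2 by (simp add: complex_eq_iff power2_eq_square algebra_simps)
  have v: "rmat p *\<^sub>v v = 1 \<cdot>\<^sub>v (v :: complex Matrix.vec) \<longleftrightarrow>
      a * vec_index v 0 + b * vec_index v 1 = vec_index v 0
    \<and> cnj b * vec_index v 0 + cnj a * vec_index v 1 = vec_index v 1" if "dim_vec v = 2" for v
    using that by (auto simp: p Matrix.vec_eq_iff scalar_prod_def sum_upto_2 less_2_cases_iff rmat_def)
  have nz: "v \<noteq> 0\<^sub>v 2 \<longleftrightarrow> vec_index v 0 \<noteq> 0 \<or> vec_index v 1 \<noteq> 0" if "dim_vec v = 2" for v :: "complex Matrix.vec"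
    using that by (auto simp: Matrix.vec_eq_iff less_2_cases_iff)
  have "eigenvalue (rmat p) 1 \<longleftrightarrow>
    (\<exists>x y. (x \<noteq> 0 \<or> y \<noteq> 0) \<and> a * x + b * y = x \<and> cnj b * x + cnj a * y = y)"
    (is "?L \<longleftrightarrow> ?R")
  proof
    assume ?L
    then obtain w where "dim_vec w = 2" "w \<noteq> 0\<^sub>v 2" "rmat p *\<^sub>v w = 1 \<cdot>\<^sub>v w"
      unfolding eigenvalue_def eigenvector_def carrier_vec_def rmat_dim by blast
    then show ?R using v[of w] nz[of w] by metis
  next
    assume ?R
    then obtain x y where xy: "x \<noteq> 0 \<or> y \<noteq> 0" "a * x + b * y = x" "cnj b * x + cnj a * y = y" by blast
    define w where "w = vec_of_list [x, y]"
    have w: "dim_vec w = 2" "vec_index w 0 = x" "vec_index w 1 = y"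
      by (simp_all add: w_def vec_of_list_index)
    have "eigenvector (rmat p) w 1"
      unfolding eigenvector_def carrier_vec_def rmat_dim mem_Collect_eq
      using v[OF w(1)] nz[OF w(1)] xy unfolding w by metis
    then show ?L unfolding eigenvalue_def by blast
  qed
  also have "\<dots> \<longleftrightarrow> (a - 1) * (cnj a - 1) - b * cnj b = 0"
  proof safe
    fix x y assume *: "a * x + b * y = x" "cnj b * x + cnj a * y = y"
    \<comment> \<open>The adjugate of \<open>rmat p - 1\<close> is applied to the two eigenvector
      equations.\<close>
    have "((a - 1) * (cnj a - 1) - b * cnj b) * x
        = (cnj a - 1) * (a * x + b * y - x) - b * (cnj b * x + cnj a * y - y)"
      and "((a - 1) * (cnj a - 1) - b * cnj b) * y
        = (a - 1) * (cnj b * x + cnj a * y - y) - cnj b * (a * x + b * y - x)"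
      by (simp_all add: algebra_simps)
    then have 0: "((a - 1) * (cnj a - 1) - b * cnj b) * x = 0" "((a - 1) * (cnj a - 1) - b * cnj b) * y = 0"
      unfolding * by simp_all
    show "(a - 1) * (cnj a - 1) - b * cnj b = 0" if "x \<noteq> 0" using that 0(1) by simp
    show "(a - 1) * (cnj a - 1) - b * cnj b = 0" if "y \<noteq> 0" using that 0(2) by simp
  next
    assume *: "(a - 1) * (cnj a - 1) - b * cnj b = 0"
    show "\<exists>x y. (x \<noteq> 0 \<or> y \<noteq> 0) \<and> a * x + b * y = x \<and> cnj b * x + cnj a * y = y"
    proof (cases "b = 0")
      case True
      with * have "a = 1" by (auto simp: complex_eq_iff)
      with True show ?thesis by (intro exI[of _ 1] exI[of _ 0]) simp
    next
      case False
      \<comment> \<open>The first row of \<open>rmat p - 1\<close> annihilates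
        \<open>(b, 1 - a)\<close>; the vanishing determinant takes care of the second row.\<close>
      with * show ?thesis by (intro exI[of _ b] exI[of _ "1 - a"]) (simp add: algebra_simps)
    qed
  qed
  also have "\<dots> \<longleftrightarrow> rdet p - rtr p + 1 = 0" using eq by (metis of_real_0 of_real_eq_iff)
  finally show ?thesis .
qed

text \<open>Trace 2 and determinant 1 make 1 a double eigenvalue, so the Jordan form is either the
  identity or a single block of size 2.\<close>

lemma dim_gen_eigenspace_rmat_one:
  assumes "rdet p = 1" "rtr p = 2"
  shows "dim_gen_eigenspace (rmat p) 1 1 = (if p = (1, 0) then 2 else 1)"
proof (cases "p = (1, 0)")
  case True
  have "jordan_matrix [(1, 1), (1, 1)] = (1\<^sub>m 2 :: complex mat)"
    by (rule mat2_eqI) (auto simp: jordan_matrix_def Let_def)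
  then have "jordan_nf (1\<^sub>m 2 :: complex mat) [(1, 1), (1, 1)]"
    using similar_mat_refl[of "1\<^sub>m 2 :: complex mat" 2] unfolding jordan_nf_def by simp
  from dim_gen_eigenspace[OF this] True show ?thesis
    by (simp add: rmat_one numeral_2_eq_2)
next
  case False
  obtain a b where p: "p = (a, b)" by fastforce
  have Re: "Re a = 1" and Im: "(Im a)\<^sup>2 = (cmod b)\<^sup>2"
    using assms by (simp_all add: p rtr_def rdet_def cmod_power2)
  have b: "b \<noteq> 0"
  proof
    assume "b = 0"
    then have "Im a = 0" using Im by simp
    with Re \<open>b = 0\<close> False show False by (simp add: p complex_eq_iff)
  qed
  have a: "a = 1 + \<i> * of_real (Im a)" using Re by (simp add: complex_eq_iff)
  have "b * cnj b = of_real ((Im a)\<^sup>2)" using Im by (simp only: complex_norm_square)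
  then have ab: "b * cnj b = - ((a - 1) * (a - 1))"
    by (subst (1 2) a) (simp add: power2_eq_square complex_eq_iff)
  have ca: "cnj a = 2 - a" using Re by (simp add: complex_eq_iff)
  have jb: "jordan_block 2 1 = (mat_of_rows_list 2 [[1, 1], [0, 1]] :: complex mat)"
    by (rule mat2_eqI) auto
  \<comment> \<open>The columns of \<open>P\<close> form a Jordan chain: \<open>(b, 1 - a)\<close>
    is an eigenvector and is the image of \<open>(0, 1)\<close> under \<open>rmat p - 1\<close>,
    because \<open>cnj a = 2 - a\<close>.\<close>
  define P where "P = mat_of_rows_list 2 [[b, 0], [1 - a, 1]]"
  define Q where "Q = mat_of_rows_list 2 [[1 / b, 0], [(a - 1) / b, 1]]"
  have "similar_mat (rmat p) (jordan_block 2 1)"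
  proof (rule similar_matI)
    show "{rmat p, jordan_block 2 1, P, Q} \<subseteq> carrier_mat 2 2"
      by (auto simp: P_def Q_def)
    show "P * Q = 1\<^sub>m 2" "Q * P = 1\<^sub>m 2"
      using b by (simp_all add: P_def Q_def mat2_mult mat2_one field_simps)
    have "(1 - a) / b + (1 - a + 1) * ((a - 1) / b) = cnj b"
    proof -
      have "(1 - a) / b + (1 - a + 1) * ((a - 1) / b) = - ((a - 1) * (a - 1)) / b"
        using b by (simp add: divide_simps) (simp add: algebra_simps)
      also have "\<dots> = cnj b" using b unfolding ab[symmetric] by simp
      finally show ?thesis .
    qed
    moreover have "(1 - a + 1) = cnj a" using ca by simp
    moreover have "b / b + b * ((a - 1) / b) = a" using b by simp
    ultimately show "rmat p = P * jordan_block 2 1 * Q"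
      by (simp add: p rmat_def P_def Q_def jb mat2_mult)
  qed
  moreover have "jordan_matrix [(2, 1)] = (jordan_block 2 1 :: complex mat)"
    by (rule mat2_eqI) (auto simp: jordan_matrix_def Let_def)
  ultimately have "jordan_nf (rmat p) [(2, 1)]" by (simp add: jordan_nf_def)
  from dim_gen_eigenspace[OF this] False show ?thesis by simp
qed

section \<open>Closed paths of signs\<close>

text \<open>The sign after the last one is a parameter \<open>s\<close> instead of the first sign of
  the path, so that the sums can be built up by a transfer matrix; \<open>s = 1\<close> closes a
  path that starts with sign 1.\<close>

definition path_weight :: "(nat \<Rightarrow> real) \<Rightarrow> nat \<Rightarrow> (nat \<Rightarrow> real) \<Rightarrow> real \<Rightarrow> real" where
  "path_weight c k \<zeta> s = (\<Prod>j=1..k. if \<zeta> j = (\<zeta>(Suc k := s)) (Suc j) then 1 else c j)"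

definition path_sum :: "(nat \<Rightarrow> real) \<Rightarrow> (nat \<Rightarrow> real) \<Rightarrow> real \<Rightarrow> nat \<Rightarrow> real \<Rightarrow> complex" where
  "path_sum c ell \<sigma> k s = (\<Sum>\<zeta>\<in>{\<zeta> \<in> signvecs k. \<zeta> 1 = 1}.
     of_real (path_weight c k \<zeta> s) * cis ((\<Sum>j=1..k. ell j * \<zeta> j) * \<sigma>))"

lemma signvecs_one: "{\<zeta> \<in> signvecs 1. \<zeta> 1 = 1} = {\<lambda>j\<in>{1}. 1}"
proof -
  have "{\<zeta> \<in> signvecs 1. \<zeta> 1 = 1} = Pi\<^sub>E {1} (\<lambda>j. {(\<lambda>j\<in>{1}. 1) j})"
    unfolding signvecs_def by (intro equalityI subsetI) (auto simp: PiE_iff)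
  then show ?thesis by (simp only: PiE_singleton[OF restrict_extensional])
qed

lemma image_Times_filter:
  "(\<And>y z. P (f (y, z)) \<longleftrightarrow> P z) \<Longrightarrow> f ` (Y \<times> {z \<in> Z. P z}) = {w \<in> f ` (Y \<times> Z). P w}"
proof -
  assume *: "\<And>y z. P (f (y, z)) \<longleftrightarrow> P z"
  have "f ` (Y \<times> {z \<in> Z. P z}) = {w. \<exists>y\<in>Y. \<exists>z\<in>Z. w = f (y, z) \<and> P z}" by blast
  also have "\<dots> = {w. \<exists>y\<in>Y. \<exists>z\<in>Z. w = f (y, z) \<and> P (f (y, z))}" unfolding * ..
  also have "\<dots> = {w \<in> f ` (Y \<times> Z). P w}" by blast
  finally show ?thesis .
qed

lemma sum_signvecs_Suc:
  assumes "k \<ge> 1"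
  shows "sum F {\<zeta> \<in> signvecs (Suc k). \<zeta> 1 = 1} =
    (\<Sum>y\<in>{-1, 1}. \<Sum>\<zeta>\<in>{\<zeta> \<in> signvecs k. \<zeta> 1 = 1}. F (\<zeta>(Suc k := y)))"
proof -
  let ?S = "{\<zeta> \<in> signvecs k. \<zeta> 1 = 1}"
  have "(\<lambda>(y, \<zeta>). \<zeta>(Suc k := y)) ` ({-1, 1} \<times> ?S) = {\<zeta> \<in> signvecs (Suc k). \<zeta> 1 = 1}"
  proof -
    have "signvecs (Suc k) = (\<lambda>(y, \<zeta>). \<zeta>(Suc k := y)) ` ({-1, 1} \<times> signvecs k)"
      unfolding signvecs_def atLeastAtMostSuc_conv[of 1 k, OF le_SucI[OF assms]] PiE_insert_eq ..
    \<comment> \<open>Since \<open>k\<close> is at least 1, the appended sign never overwrites the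
      first one.\<close>
    moreover have "(case (y, \<zeta>) of (y, \<zeta>) \<Rightarrow> \<zeta>(Suc k := y)) 1 = 1 \<longleftrightarrow> \<zeta> 1 = 1"
      for \<zeta> :: "nat \<Rightarrow> real" and y using assms by simp
    from image_Times_filter[where P = "\<lambda>\<zeta>. \<zeta> 1 = 1" and f = "\<lambda>(y, \<zeta>). \<zeta>(Suc k := y)", OF this]
    have "(\<lambda>(y, \<zeta>). \<zeta>(Suc k := y)) ` ({-1, 1} \<times> ?S)
      = {\<zeta> \<in> (\<lambda>(y, \<zeta>). \<zeta>(Suc k := y)) ` ({-1, 1} \<times> signvecs k). \<zeta> 1 = 1}" .
    ultimately show ?thesis by (simp only:)
  qed
  moreover have "inj_on (\<lambda>(y, \<zeta>). \<zeta>(Suc k := y)) ({-1, 1} \<times> ?S)"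
    by (rule inj_on_subset[OF inj_combinator[of "Suc k" "{1..k}" "\<lambda>_. {-1, 1 :: real}"]])
       (auto simp: signvecs_def)
  from sum.reindex[OF this, of F]
  have "sum F ((\<lambda>(y, \<zeta>). \<zeta>(Suc k := y)) ` ({-1, 1} \<times> ?S))
      = (\<Sum>(y, \<zeta>)\<in>{-1, 1} \<times> ?S. F (\<zeta>(Suc k := y)))"
    by (simp only: o_def case_prod_unfold)
  ultimately show ?thesis by (simp only: sum.cartesian_product)
qed

lemma path_sum_one: "path_sum c ell \<sigma> 1 s = of_real (if s = 1 then 1 else c 1) * cis (ell 1 * \<sigma>)"
  unfolding path_sum_def signvecs_one by (auto simp: path_weight_def)

text \<open>A vertex factor only compares the signs on its two sides, so fixing the last sign
  \<open>y\<close> decouples the new factor from the earlier ones.\<close>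

lemma path_sum_Suc:
  assumes "k \<ge> 1"
  shows "path_sum c ell \<sigma> (Suc k) s =
    (\<Sum>y\<in>{-1, 1}. of_real (if y = s then 1 else c (Suc k)) * cis (ell (Suc k) * y * \<sigma>) * path_sum c ell \<sigma> k y)"
proof -
  have w: "path_weight c (Suc k) (\<zeta>(Suc k := y)) s = (if y = s then 1 else c (Suc k)) * path_weight c k \<zeta> y" for \<zeta> y
  proof -
    have "path_weight c (Suc k) (\<zeta>(Suc k := y)) s =
        (\<Prod>j=1..k. if (\<zeta>(Suc k := y)) j = (\<zeta>(Suc k := y, Suc (Suc k) := s)) (Suc j) then 1 else c j)
         * (if y = s then 1 else c (Suc k))"
      unfolding path_weight_def by (simp add: prod.nat_ivl_Suc')
    also have "(\<Prod>j=1..k. if (\<zeta>(Suc k := y)) j = (\<zeta>(Suc k := y, Suc (Suc k) := s)) (Suc j) then 1 else c j)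
      = path_weight c k \<zeta> y"
      unfolding path_weight_def by (rule prod.cong) auto
    finally show ?thesis by (metis mult.commute)
  qed
  have s: "cis ((\<Sum>j=1..Suc k. ell j * (\<zeta>(Suc k := y)) j) * \<sigma>)
      = cis (ell (Suc k) * y * \<sigma>) * cis ((\<Sum>j=1..k. ell j * \<zeta> j) * \<sigma>)" for \<zeta> y
  proof -
    have "(\<Sum>j=1..k. ell j * (\<zeta>(Suc k := y)) j) = (\<Sum>j=1..k. ell j * \<zeta> j)" by (rule sum.cong) auto
    then show ?thesis by (simp add: cis_mult algebra_simps)
  qed
  show ?thesis
    unfolding path_sum_def sum_signvecs_Suc[OF assms] w s sum_distrib_left
    by (intro sum.cong refl) (simp add: mult_ac)
qed

text \<open>Entering or leaving \<open>-1\<close> costs a factor \<open>\<plusminus>\<i>\<close>; around a closed path these cancel in pairs.\<close>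
lemma seg_eq_path_sum:
  assumes "k \<ge> 1"
  shows "seg (\<lambda>j. rN (\<alpha> j) \<star> rB (ell j) \<sigma>) 0 k =
    (path_sum (\<lambda>j. cos (pi\<^sup>2 / (2 * \<alpha> j))) ell \<sigma> k 1,
     - \<i> * cnj (path_sum (\<lambda>j. cos (pi\<^sup>2 / (2 * \<alpha> j))) ell \<sigma> k (-1)))"
  using assms
proof (induction k rule: nat_induct_at_least)
  case base
  then show ?case by (simp add: path_sum_one[unfolded One_nat_def] rN_def rB_def cis_cnj)
next
  case (Suc k)
  then show ?case
    by (simp add: path_sum_Suc rN_def rB_def cis_cnj algebra_simps)
qed

lemma pfrak_eq_path_weight:
  assumes "\<zeta> 1 = 1"
  shows "pfrak n \<zeta> \<alpha> = path_weight (\<lambda>j. cos (pi\<^sup>2 / (2 * \<alpha> j))) n \<zeta> 1"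
proof -
  \<comment> \<open>At \<open>j = n\<close> the cyclic successor is index 1, whose sign is 1 by
    assumption; this is the value stored at position \<open>Suc n\<close>.\<close>
  have next_sign: "\<zeta> (cidx n (j + 1)) = (\<zeta>(Suc n := 1)) (Suc j)" if "j \<in> {1..n}" for j
    using that assms by (cases "j = n") (auto simp: cidx_def)
  show ?thesis unfolding pfrak_def changes_def path_weight_def prod.inter_filter[OF finite_atLeastAtMost]
    by (rule prod.cong) (simp_all add: next_sign[simplified])
qed

text \<open>The first component of the cleared product sums over the sign paths that return to 1,
  and its real part turns each \<open>cis\<close> into a cosine.\<close>

lemma FP_eq_rtr:
  assumes "n \<ge> 1"
  shows "FP n \<alpha> ell \<sigma> = rtr (seg (\<lambda>j. rN (\<alpha> j) \<star> rB (ell j) \<sigma>) 0 n) / 2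
    - (\<Prod>j=1..n. sin (pi\<^sup>2 / (2 * \<alpha> j)))"
proof -
  have "(\<Sum>\<zeta>\<in>{\<zeta> \<in> signvecs n. \<zeta> 1 = 1}. pfrak n \<zeta> \<alpha> * cos ((\<Sum>j=1..n. ell j * \<zeta> j) * \<sigma>))
    = Re (path_sum (\<lambda>j. cos (pi\<^sup>2 / (2 * \<alpha> j))) ell \<sigma> n 1)"
    unfolding path_sum_def Re_sum by (rule sum.cong) (auto simp: pfrak_eq_path_weight)
  then show ?thesis by (simp only: FP_def seg_eq_path_sum[OF assms] rtr_def fst_conv)
qed

section \<open>Multiplicities of roots\<close>

text \<open>\<open>deriv\<close> is total and unspecified where no derivative exists, so
  differentiability is recorded at every order.\<close>

definition smooth :: "(real \<Rightarrow> real) \<Rightarrow> bool" where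
  "smooth f \<longleftrightarrow> (\<forall>k x. (deriv ^^ k) f differentiable at x)"

text \<open>The formal Taylor series, with no question of convergence. Root multiplicity becomes the
  subdegree, which is additive over products because real power series have no zero
  divisors.\<close>

definition taylor :: "(real \<Rightarrow> real) \<Rightarrow> real \<Rightarrow> real fps" where
  "taylor f s = Abs_fps (\<lambda>k. (deriv ^^ k) f s / fact k)"

lemma smooth_deriv: "smooth f \<Longrightarrow> ((deriv ^^ k) f has_real_derivative (deriv ^^ Suc k) f x) (at x)"
  using DERIV_deriv_iff_real_differentiable by (auto simp: smooth_def)

text \<open>It suffices to guess all iterated derivatives at once and to check that each guess
  differentiates to the next.\<close>

lemma derivative_tower:
  assumes "F 0 = f" and F: "\<And>k x. (F k has_real_derivative F (Suc k) x) (at x)"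
  shows "(deriv ^^ k) f = F k" "smooth f"
proof -
  show *: "(deriv ^^ k) f = F k" for k
    by (induction k) (use assms in \<open>auto intro!: DERIV_imp_deriv\<close>)
  show "smooth f" unfolding smooth_def * using F real_differentiable_def by blast
qed

lemma smooth_const: "smooth (\<lambda>x. c)"
  by (rule derivative_tower(2)[where F = "\<lambda>k x. if k = 0 then c else 0"]) auto

lemma smooth_cos: "smooth (\<lambda>x. cos (l * x + c))"
\<comment> \<open>Each differentiation of the cosine advances its phase by a quarter turn.\<close>
proof (rule derivative_tower(2)[where F = "\<lambda>k x. l ^ k * cos (l * x + c + k * pi / 2)"])
  fix k x
  have "l * x + c + real (Suc k) * pi / 2 = (l * x + c + k * pi / 2) + pi / 2"
    by (simp add: field_simps)
  then have "cos (l * x + c + real (Suc k) * pi / 2) = - sin (l * x + c + k * pi / 2)"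
    by (simp only: cos_add) simp
  then show "((\<lambda>x. l ^ k * cos (l * x + c + k * pi / 2)) has_real_derivative
        l ^ Suc k * cos (l * x + c + real (Suc k) * pi / 2)) (at x)"
    by (auto intro!: derivative_eq_intros)
qed simp

lemma smooth_sin: "smooth (\<lambda>x. sin (l * x))"
proof -
  have "(\<lambda>x. sin (l * x)) = (\<lambda>x. cos (l * x + (- (pi / 2))))"
    by (simp add: cos_diff)
  then show ?thesis using smooth_cos by metis
qed

lemma smooth_add: "smooth f \<Longrightarrow> smooth g \<Longrightarrow> smooth (\<lambda>x. f x + g x)"
  by (rule derivative_tower(2)[where F = "\<lambda>k x. (deriv ^^ k) f x + (deriv ^^ k) g x"])
     (auto intro!: derivative_intros smooth_deriv simp del: funpow.simps)

lemma
  assumes f: "smooth f" and g: "smooth g"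
  shows smooth_mult: "smooth (\<lambda>x. f x * g x)"
    and deriv_funpow_mult: "(deriv ^^ k) (\<lambda>x. f x * g x) =
      (\<lambda>x. \<Sum>i=0..k. of_nat (k choose i) * (deriv ^^ i) f x * (deriv ^^ (k - i)) g x)"
proof -
  define H where "H k x = (\<Sum>i=0..k. of_nat (k choose i) * (deriv ^^ i) f x * (deriv ^^ (k - i)) g x)" for k x
  have "(H k has_real_derivative H (Suc k) x) (at x)" for k x
  proof -
    let ?f = "\<lambda>i. (deriv ^^ i) f x" and ?g = "\<lambda>i. (deriv ^^ i) g x"
    have "H (Suc k) x = (\<Sum>i=0..k. of_nat (k choose i) * (?f (Suc i) * ?g (k - i) + ?f i * ?g (Suc (k - i))))"
    proof -
      \<comment> \<open>Pascal's rule, prepared by index shifts: the bottom term is split off in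
        \<open>1\<close> and absorbed again in \<open>2\<close>, and the top term vanishes in
        \<open>3\<close>.\<close>
      have 1: "(\<Sum>i=0..Suc k. of_nat (Suc k choose i) * ?f i * ?g (Suc k - i)) =
         ?f 0 * ?g (Suc k) + (\<Sum>i=0..k. of_nat (Suc k choose Suc i) * ?f (Suc i) * ?g (k - i))"
        by (simp only: sum.atLeast0_atMost_Suc_shift) (simp del: funpow.simps)
      have 2: "?f 0 * ?g (Suc k) + (\<Sum>i=0..k. of_nat (k choose Suc i) * ?f (Suc i) * ?g (k - i))
        = (\<Sum>i=0..Suc k. of_nat (k choose i) * ?f i * ?g (Suc k - i))"
        by (simp only: sum.atLeast0_atMost_Suc_shift) (simp del: funpow.simps)
      have 3: "(\<Sum>i=0..Suc k. of_nat (k choose i) * ?f i * ?g (Suc k - i))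
        = (\<Sum>i=0..k. of_nat (k choose i) * ?f i * ?g (Suc (k - i)))"
        by (simp del: funpow.simps add: Suc_diff_le)
      show ?thesis unfolding H_def 1
        using 2 unfolding 3 by (simp del: funpow.simps add: algebra_simps sum.distrib)
    qed
    moreover have "((\<lambda>x. of_nat (k choose i) * (deriv ^^ i) f x * (deriv ^^ (k - i)) g x) has_real_derivative
        of_nat (k choose i) * (?f (Suc i) * ?g (k - i) + ?f i * ?g (Suc (k - i)))) (at x)" for i
      by (rule DERIV_cong, rule DERIV_mult[OF DERIV_cmult[OF smooth_deriv[OF f]] smooth_deriv[OF g]])
         (simp only: algebra_simps)
    ultimately show ?thesis unfolding H_def by (simp only: DERIV_sum)
  qed
  moreover have "H 0 = (\<lambda>x. f x * g x)" by (simp add: H_def fun_eq_iff)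
  ultimately have "(deriv ^^ k) (\<lambda>x. f x * g x) = H k" and *: "smooth (\<lambda>x. f x * g x)"
    using derivative_tower[of H] by blast+
  then show "(deriv ^^ k) (\<lambda>x. f x * g x) =
      (\<lambda>x. \<Sum>i=0..k. of_nat (k choose i) * (deriv ^^ i) f x * (deriv ^^ (k - i)) g x)"
    by (auto simp: H_def)
  show "smooth (\<lambda>x. f x * g x)" by (rule *)
qed

text \<open>The factorials in \<open>taylor\<close> turn the Leibniz formula into the Cauchy
  product.\<close>

lemma taylor_mult:
  assumes "smooth f" "smooth g"
  shows "taylor (\<lambda>x. f x * g x) s = taylor f s * taylor g s"
  by (rule fps_ext)
     (auto simp: taylor_def deriv_funpow_mult[OF assms] fps_mult_nth sum_divide_distrib binomial_fact
        intro!: sum.cong)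

lemma root_mult_eq_subdegree: "taylor f s \<noteq> 0 \<Longrightarrow> root_mult f s = subdegree (taylor f s)"
  by (simp add: root_mult_def subdegree_def taylor_def)

lemma
  assumes "smooth f" "f s = 0 \<Longrightarrow> deriv f s \<noteq> 0"
  shows taylor_simple_nonzero: "taylor f s \<noteq> 0"
    and subdegree_taylor_simple: "subdegree (taylor f s) = of_bool (f s = 0)"
proof -
  have n0: "fps_nth (taylor f s) 0 = f s" and n1: "fps_nth (taylor f s) 1 = deriv f s"
    by (simp_all add: taylor_def)
  show "taylor f s \<noteq> 0" using n0 n1 assms(2) by (metis fps_zero_nth)
  show "subdegree (taylor f s) = of_bool (f s = 0)"
    using n0 n1 assms(2) by (cases "f s = 0") (auto intro!: subdegreeI)
qed

text \<open>Every factor has at most a simple zero at \<open>s\<close> and so contributes 0 or 1 to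
  the subdegree. Nonvanishing of the series is carried through the induction because additivity of
  the subdegree requires it.\<close>

lemma taylor_prod:
  assumes "finite A" "\<And>e. e \<in> A \<Longrightarrow> smooth (g e)" "\<And>e. e \<in> A \<Longrightarrow> g e s = 0 \<Longrightarrow> deriv (g e) s \<noteq> 0"
  shows "smooth (\<lambda>x. \<Prod>e\<in>A. g e x) \<and> taylor (\<lambda>x. \<Prod>e\<in>A. g e x) s \<noteq> 0
    \<and> subdegree (taylor (\<lambda>x. \<Prod>e\<in>A. g e x) s) = card {e \<in> A. g e s = 0}"
  using assms
proof (induction A rule: finite_induct)
  case empty
  then show ?case
    using smooth_const[of 1] taylor_simple_nonzero[of "\<lambda>x. 1"] subdegree_taylor_simple[of "\<lambda>x. 1"] by simp
next
  case (insert a A)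
  then have IH: "smooth (\<lambda>x. \<Prod>e\<in>A. g e x)" "taylor (\<lambda>x. \<Prod>e\<in>A. g e x) s \<noteq> 0"
    "subdegree (taylor (\<lambda>x. \<Prod>e\<in>A. g e x) s) = card {e \<in> A. g e s = 0}" by simp_all
  have a: "smooth (g a)" "g a s = 0 \<Longrightarrow> deriv (g a) s \<noteq> 0" using insert.prems by auto
  have "{e \<in> insert a A. g e s = 0} = (if g a s = 0 then insert a {e \<in> A. g e s = 0} else {e \<in> A. g e s = 0})"
    by auto
  then have "card {e \<in> insert a A. g e s = 0} = of_bool (g a s = 0) + card {e \<in> A. g e s = 0}"
    using insert.hyps by simp
  then show ?case
    using insert.hyps IH a smooth_mult[OF a(1) IH(1)] taylor_mult[OF a(1) IH(1)]
      taylor_simple_nonzero[OF a] subdegree_taylor_simple[OF a]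
    by (simp add: subdegree_mult)
qed

lemma root_mult_prod:
  assumes "finite A" "\<And>e. e \<in> A \<Longrightarrow> smooth (g e)" "\<And>e. e \<in> A \<Longrightarrow> g e s = 0 \<Longrightarrow> deriv (g e) s \<noteq> 0" "c \<noteq> 0"
  shows "root_mult (\<lambda>x. c * (\<Prod>e\<in>A. g e x)) s = card {e \<in> A. g e s = 0}"
proof -
  let ?p = "\<lambda>x. \<Prod>e\<in>A. g e x"
  have P: "smooth ?p" "taylor ?p s \<noteq> 0" "subdegree (taylor ?p s) = card {e \<in> A. g e s = 0}"
    using taylor_prod[of A g s] assms(1-3) by blast+
  have C: "taylor (\<lambda>x. c) s \<noteq> 0" "subdegree (taylor (\<lambda>x. c) s) = 0"
    using taylor_simple_nonzero[OF smooth_const] subdegree_taylor_simple[OF smooth_const] assms(4) by auto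
  have "taylor (\<lambda>x. c * ?p x) s = taylor (\<lambda>x. c) s * taylor ?p s"
    by (intro taylor_mult smooth_const P(1))
  moreover from this have "taylor (\<lambda>x. c * ?p x) s \<noteq> 0" using P(2) C(1) by simp
  ultimately show ?thesis
    using root_mult_eq_subdegree subdegree_mult[OF C(1) P(2)] C(2) P(3) by simp
qed

lemma root_mult_eq_one: "f s = 0 \<Longrightarrow> deriv f s \<noteq> 0 \<Longrightarrow> root_mult f s = 1"
  unfolding root_mult_def by (rule Least_equality) (auto simp: Suc_le_eq intro!: Nat.gr0I)

lemma root_mult_eq_two: "f s = 0 \<Longrightarrow> deriv f s = 0 \<Longrightarrow> deriv (deriv f) s \<noteq> 0 \<Longrightarrow> root_mult f s = 2"
  unfolding root_mult_def
proof (rule Least_equality)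
  assume *: "f s = 0" "deriv f s = 0" "deriv (deriv f) s \<noteq> 0"
  show "(deriv ^^ 2) f s \<noteq> 0" using * by (simp add: numeral_2_eq_2)
  show "2 \<le> k" if "(deriv ^^ k) f s \<noteq> 0" for k
  proof (rule ccontr)
    assume "\<not> 2 \<le> k"
    then have "k = 0 \<or> k = 1" by linarith
    then show False using * that by auto
  qed
qed

section \<open>Polygons without exceptional angles\<close>

text \<open>The derivative of a path \<open>p\<close> of determinant \<open>1\<close> is \<open>p \<star> (\<i> h, \<i> k)\<close>; the pair \<open>(h, k)\<close> stands
  for the Hermitian matrix with diagonal \<open>h\<close> and off-diagonal entry \<open>k\<close>, positive semidefinite here.\<close>
definition positive_flow :: "(real \<Rightarrow> complex \<times> complex) \<Rightarrow> (real \<Rightarrow> real) \<Rightarrow> (real \<Rightarrow> complex) \<Rightarrow> bool" where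
  "positive_flow p h k \<longleftrightarrow> (\<forall>\<sigma>. rdet (p \<sigma>) = 1 \<and> cmod (k \<sigma>) \<le> h \<sigma>
     \<and> h differentiable at \<sigma> \<and> k differentiable at \<sigma>
     \<and> ((\<lambda>\<sigma>. fst (p \<sigma>)) has_vector_derivative \<i> * (fst (p \<sigma>) * h \<sigma> - snd (p \<sigma>) * cnj (k \<sigma>))) (at \<sigma>)
     \<and> ((\<lambda>\<sigma>. snd (p \<sigma>)) has_vector_derivative \<i> * (fst (p \<sigma>) * k \<sigma> - snd (p \<sigma>) * h \<sigma>)) (at \<sigma>))"

lemma has_vector_derivative_cis_mult:
  assumes "(f has_vector_derivative f') (at \<sigma>)"
  shows "((\<lambda>\<sigma>. cis (l * \<sigma>) * f \<sigma>) has_vector_derivative cis (l * \<sigma>) * (\<i> * l * f \<sigma> + f')) (at \<sigma>)"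
proof -
  have "((\<lambda>\<sigma>. exp (\<i> * of_real (l * \<sigma>))) has_vector_derivative \<i> * l * exp (\<i> * of_real (l * \<sigma>))) (at \<sigma>)"
  proof -
    have "((\<lambda>z. exp (\<i> * l * z)) has_field_derivative exp (\<i> * l * of_real \<sigma>) * (\<i> * l)) (at (of_real \<sigma>))"
      by (auto intro!: derivative_eq_intros)
    from has_vector_derivative_real_field[OF this] show ?thesis by (simp add: mult_ac)
  qed
  then have "((\<lambda>\<sigma>. cis (l * \<sigma>)) has_vector_derivative \<i> * l * cis (l * \<sigma>)) (at \<sigma>)"
    by (simp add: cis_conv_exp)
  from has_vector_derivative_mult[OF this assms] show ?thesis
    by (simp add: algebra_simps)
qed

lemma positive_flow_one: "positive_flow (\<lambda>\<sigma>. (1, 0)) (\<lambda>\<sigma>. 0) (\<lambda>\<sigma>. 0)"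
  by (simp add: positive_flow_def rdet_def)

text \<open>Left multiplication by a constant does not change the logarithmic derivative, so
  \<open>h\<close> and \<open>k\<close> stay the same.\<close>

lemma positive_flow_rA:
  assumes "positive_flow p h k" "rdet q = 1"
  shows "positive_flow (\<lambda>\<sigma>. q \<star> p \<sigma>) h k"
  unfolding positive_flow_def
proof (intro allI conjI)
  fix \<sigma>
  obtain u v where q: "q = (u, v)" by fastforce
  define a b where "a \<sigma> = fst (p \<sigma>)" and "b \<sigma> = snd (p \<sigma>)" for \<sigma>
  have p: "p \<sigma> = (a \<sigma>, b \<sigma>)" for \<sigma> by (simp add: a_def b_def)
  have *: "rdet (p \<sigma>) = 1" "cmod (k \<sigma>) \<le> h \<sigma>" "h differentiable at \<sigma>" "k differentiable at \<sigma>"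
    and a: "(a has_vector_derivative \<i> * (a \<sigma> * h \<sigma> - b \<sigma> * cnj (k \<sigma>))) (at \<sigma>)"
    and b: "(b has_vector_derivative \<i> * (a \<sigma> * k \<sigma> - b \<sigma> * h \<sigma>)) (at \<sigma>)"
    using assms(1) by (simp_all add: positive_flow_def p)
  show "rdet (q \<star> p \<sigma>) = 1" using * assms(2) by (simp add: rdet_rcomp)
  show "cmod (k \<sigma>) \<le> h \<sigma>" "h differentiable at \<sigma>" "k differentiable at \<sigma>" by (fact *)+
  show "((\<lambda>\<sigma>. fst (q \<star> p \<sigma>)) has_vector_derivative
      \<i> * (fst (q \<star> p \<sigma>) * h \<sigma> - snd (q \<star> p \<sigma>) * cnj (k \<sigma>))) (at \<sigma>)"
    unfolding q p rcomp.simps fst_conv snd_conv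
    by (rule has_vector_derivative_eq_rhs[OF has_vector_derivative_add[OF
          has_vector_derivative_mult_right[OF a] has_vector_derivative_mult_right[OF has_vector_derivative_cnj[OF b]]]])
       (simp add: algebra_simps)
  show "((\<lambda>\<sigma>. snd (q \<star> p \<sigma>)) has_vector_derivative
      \<i> * (fst (q \<star> p \<sigma>) * k \<sigma> - snd (q \<star> p \<sigma>) * h \<sigma>)) (at \<sigma>)"
    unfolding q p rcomp.simps fst_conv snd_conv
    by (rule has_vector_derivative_eq_rhs[OF has_vector_derivative_add[OF
          has_vector_derivative_mult_right[OF b] has_vector_derivative_mult_right[OF has_vector_derivative_cnj[OF a]]]])
       (simp add: algebra_simps)
qed

text \<open>Multiplying by \<open>rB l\<close> on the left adds to the logarithmic derivative the
  conjugate of the generator \<open>\<i> * l\<close> by \<open>p\<close>. In terms of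
  \<open>p = (a, b)\<close> this adds \<open>l (|a|^2 + |b|^2)\<close> to \<open>h\<close> and
  \<open>2 l cnj a b\<close> to \<open>k\<close>.\<close>

lemma
  assumes flow: "positive_flow p h k" and l: "l > 0"
  defines "h' \<equiv> \<lambda>\<sigma>. h \<sigma> + l * Re (fst (p \<sigma>) * cnj (fst (p \<sigma>)) + snd (p \<sigma>) * cnj (snd (p \<sigma>)))"
    and "k' \<equiv> \<lambda>\<sigma>. k \<sigma> + 2 * l * (cnj (fst (p \<sigma>)) * snd (p \<sigma>))"
  shows positive_flow_rB_strict: "cmod (k' \<sigma>) < h' \<sigma>"
    and positive_flow_rB: "positive_flow (\<lambda>\<sigma>. rB l \<sigma> \<star> p \<sigma>) h' k'"
proof -
  define a b where "a \<sigma> = fst (p \<sigma>)" and "b \<sigma> = snd (p \<sigma>)" for \<sigma>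
  have p: "p \<sigma> = (a \<sigma>, b \<sigma>)" for \<sigma> by (simp add: a_def b_def)
  have *: "rdet (p \<sigma>) = 1" "cmod (k \<sigma>) \<le> h \<sigma>" "h differentiable at \<sigma>" "k differentiable at \<sigma>"
    and a: "(a has_vector_derivative \<i> * (a \<sigma> * h \<sigma> - b \<sigma> * cnj (k \<sigma>))) (at \<sigma>)"
    and b: "(b has_vector_derivative \<i> * (a \<sigma> * k \<sigma> - b \<sigma> * h \<sigma>)) (at \<sigma>)" for \<sigma>
    using flow by (simp_all add: positive_flow_def p)
  have det: "(cmod (a \<sigma>))\<^sup>2 - (cmod (b \<sigma>))\<^sup>2 = 1" for \<sigma>
    using *(1)[of \<sigma>] by (simp add: rdet_def p)
  show strict: "cmod (k' \<sigma>) < h' \<sigma>" for \<sigma>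
  proof -
    \<comment> \<open>Determinant 1 excludes equality in the inequality between arithmetic and
      geometric mean, so the added term is positive definite.\<close>
    have "cmod (a \<sigma>) \<noteq> cmod (b \<sigma>)" using det[of \<sigma>] by auto
    then have "0 < (cmod (a \<sigma>) - cmod (b \<sigma>))\<^sup>2" by simp
    then have "2 * (cmod (a \<sigma>) * cmod (b \<sigma>)) < (cmod (a \<sigma>))\<^sup>2 + (cmod (b \<sigma>))\<^sup>2"
      by (simp add: power2_diff)
    then have "l * (2 * (cmod (a \<sigma>) * cmod (b \<sigma>))) < l * ((cmod (a \<sigma>))\<^sup>2 + (cmod (b \<sigma>))\<^sup>2)"
      using l by simp
    moreover have "cmod (k' \<sigma>) \<le> cmod (k \<sigma>) + l * (2 * (cmod (a \<sigma>) * cmod (b \<sigma>)))"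
      unfolding k'_def p using l norm_triangle_ineq[of "k \<sigma>" "2 * l * (cnj (a \<sigma>) * b \<sigma>)"]
      by (simp add: norm_mult)
    moreover have "h' \<sigma> = h \<sigma> + l * ((cmod (a \<sigma>))\<^sup>2 + (cmod (b \<sigma>))\<^sup>2)"
      by (simp add: h'_def p complex_mult_cnj cmod_power2)
    ultimately show ?thesis using *(2)[of \<sigma>] by linarith
  qed
  have aa: "a \<sigma> * cnj (a \<sigma>) = 1 + b \<sigma> * cnj (b \<sigma>)" for \<sigma>
  proof -
    have "(cmod (a \<sigma>))\<^sup>2 = 1 + (cmod (b \<sigma>))\<^sup>2" using det[of \<sigma>] by simp
    then have "complex_of_real ((cmod (a \<sigma>))\<^sup>2) = of_real (1 + (cmod (b \<sigma>))\<^sup>2)" by (simp only:)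
    then show ?thesis by (simp only: complex_norm_square of_real_add of_real_1)
  qed
  have h': "complex_of_real (h' \<sigma>) = h \<sigma> + l * (1 + 2 * (b \<sigma> * cnj (b \<sigma>)))" for \<sigma>
    unfolding h'_def p fst_conv snd_conv aa
    by (simp add: complex_eq_iff)
  have k': "k' \<sigma> = k \<sigma> + 2 * l * (cnj (a \<sigma>) * b \<sigma>)" for \<sigma> by (simp add: k'_def p)
  show "positive_flow (\<lambda>\<sigma>. rB l \<sigma> \<star> p \<sigma>) h' k'"
    unfolding positive_flow_def
  proof (intro allI conjI)
    fix \<sigma>
    show "rdet (rB l \<sigma> \<star> p \<sigma>) = 1" using *(1) by (simp add: rdet_rcomp rdet_rB)
    show "cmod (k' \<sigma>) \<le> h' \<sigma>" using strict[of \<sigma>] by simp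
    have d: "a differentiable at \<sigma>" "b differentiable at \<sigma>"
      using a b by (auto intro: differentiableI_vector)
    then have dc: "(\<lambda>\<sigma>. cnj (a \<sigma>)) differentiable at \<sigma>" "(\<lambda>\<sigma>. cnj (b \<sigma>)) differentiable at \<sigma>"
      using has_vector_derivative_cnj[OF a] has_vector_derivative_cnj[OF b] by (auto intro: differentiableI_vector)
    show "k' differentiable at \<sigma>" unfolding k'_def p fst_conv snd_conv
      by (intro derivative_intros *(4) d dc)
    have "(\<lambda>\<sigma>. a \<sigma> * cnj (a \<sigma>) + b \<sigma> * cnj (b \<sigma>)) differentiable at \<sigma>"
      by (intro derivative_intros d dc)
    then have "(\<lambda>\<sigma>. Re (a \<sigma> * cnj (a \<sigma>) + b \<sigma> * cnj (b \<sigma>))) differentiable at \<sigma>"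
      using differentiableI_vector[OF bounded_linear.has_vector_derivative[OF bounded_linear_Re]]
        vector_derivative_works by blast
    then show "h' differentiable at \<sigma>" unfolding h'_def p fst_conv snd_conv
      by (intro derivative_intros *(3))
    have e1: "\<i> * l * a \<sigma> + \<i> * (a \<sigma> * h \<sigma> - b \<sigma> * cnj (k \<sigma>)) = \<i> * (a \<sigma> * h' \<sigma> - b \<sigma> * cnj (k' \<sigma>))"
      unfolding h' k' by (simp add: algebra_simps)
    have e2: "\<i> * l * b \<sigma> + \<i> * (a \<sigma> * k \<sigma> - b \<sigma> * h \<sigma>) = \<i> * (a \<sigma> * k' \<sigma> - b \<sigma> * h' \<sigma>)"
    proof -
      have "a \<sigma> * k' \<sigma> = a \<sigma> * k \<sigma> + 2 * l * b \<sigma> * (a \<sigma> * cnj (a \<sigma>))"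
        unfolding k' by (simp add: algebra_simps)
      then show ?thesis unfolding h' aa by (simp add: algebra_simps)
    qed
    show "((\<lambda>\<sigma>. fst (rB l \<sigma> \<star> p \<sigma>)) has_vector_derivative
        \<i> * (fst (rB l \<sigma> \<star> p \<sigma>) * h' \<sigma> - snd (rB l \<sigma> \<star> p \<sigma>) * cnj (k' \<sigma>))) (at \<sigma>)"
      unfolding rB_def p rcomp.simps fst_conv snd_conv mult_zero_left add_0_right
      by (rule has_vector_derivative_eq_rhs[OF has_vector_derivative_cis_mult[OF a[of \<sigma>], of l, unfolded e1]])
         (simp add: algebra_simps)
    show "((\<lambda>\<sigma>. snd (rB l \<sigma> \<star> p \<sigma>)) has_vector_derivative
        \<i> * (fst (rB l \<sigma> \<star> p \<sigma>) * k' \<sigma> - snd (rB l \<sigma> \<star> p \<sigma>) * h' \<sigma>)) (at \<sigma>)"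
      unfolding rB_def p rcomp.simps fst_conv snd_conv mult_zero_left add_0_right
      by (rule has_vector_derivative_eq_rhs[OF has_vector_derivative_cis_mult[OF b[of \<sigma>], of l, unfolded e2]])
         (simp add: algebra_simps)
  qed
qed

text \<open>The empty product is constant with \<open>h = 0\<close>; strictness comes from the
  \<open>rB\<close> factor of each arc and survives the following \<open>rA\<close>.\<close>

lemma ex_positive_flow_seg:
  assumes "\<And>j. j \<in> {1..n} \<Longrightarrow> sin (pi\<^sup>2 / (2 * \<alpha> j)) \<noteq> 0" "\<And>j. j \<in> {1..n} \<Longrightarrow> 0 < ell j"
  shows "\<exists>h k. positive_flow (\<lambda>\<sigma>. seg (\<lambda>j. rA (\<alpha> j) \<star> rB (ell j) \<sigma>) 0 n) h k
    \<and> (n \<ge> 1 \<longrightarrow> (\<forall>\<sigma>. cmod (k \<sigma>) < h \<sigma>))"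
  using assms
proof (induction n)
  case 0
  then show ?case using positive_flow_one by fastforce
next
  case (Suc n)
  then obtain h k where "positive_flow (\<lambda>\<sigma>. seg (\<lambda>j. rA (\<alpha> j) \<star> rB (ell j) \<sigma>) 0 n) h k" by fastforce
  moreover have "0 < ell (Suc n)" using Suc.prems(2) by simp
  ultimately obtain h' k' where
    hk: "positive_flow (\<lambda>\<sigma>. rB (ell (Suc n)) \<sigma> \<star> seg (\<lambda>j. rA (\<alpha> j) \<star> rB (ell j) \<sigma>) 0 n) h' k'"
    "\<And>\<sigma>. cmod (k' \<sigma>) < h' \<sigma>"
    using positive_flow_rB positive_flow_rB_strict by blast
  have "rdet (rA (\<alpha> (Suc n))) = 1" using Suc.prems(1) by (intro rdet_rA) simp
  from positive_flow_rA[OF hk(1) this]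
  have "positive_flow (\<lambda>\<sigma>. seg (\<lambda>j. rA (\<alpha> j) \<star> rB (ell j) \<sigma>) 0 (Suc n)) h' k'"
    by (simp only: seg.simps add_0 rcomp_assoc)
  with hk(2) show ?case by blast
qed

text \<open>With \<open>p = (a, b)\<close>, half the trace is \<open>Re a\<close>, whose derivative
  is \<open>Im (b * cnj k) - Im a * h\<close>. Where the trace is 2, \<open>cmod b\<close> equals
  the absolute value of \<open>Im a\<close>, so strictness lets the second term dominate unless
  \<open>Im a = 0\<close>, which forces the identity.\<close>

lemma root_mult_rtr:
  assumes flow: "positive_flow p h k" and strict: "\<And>\<sigma>. cmod (k \<sigma>) < h \<sigma>"
    and f: "f = (\<lambda>\<sigma>. C * (rtr (p \<sigma>) / 2 - 1))" and "C \<noteq> 0" and tr: "rtr (p s) = 2"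
  shows "root_mult f s = (if p s = (1, 0) then 2 else 1)"
proof -
  define a b where "a \<sigma> = fst (p \<sigma>)" and "b \<sigma> = snd (p \<sigma>)" for \<sigma>
  have p: "p \<sigma> = (a \<sigma>, b \<sigma>)" for \<sigma> by (simp add: a_def b_def)
  have *: "rdet (p \<sigma>) = 1" "h differentiable at \<sigma>" "k differentiable at \<sigma>"
    and a: "(a has_vector_derivative \<i> * (a \<sigma> * h \<sigma> - b \<sigma> * cnj (k \<sigma>))) (at \<sigma>)"
    and b: "(b has_vector_derivative \<i> * (a \<sigma> * k \<sigma> - b \<sigma> * h \<sigma>)) (at \<sigma>)" for \<sigma>
    using flow by (simp_all add: positive_flow_def p)
  have f: "f = (\<lambda>\<sigma>. C * (Re (a \<sigma>) - 1))" by (simp add: f rtr_def p)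
  have Re: "Re (a s) = 1" using tr by (simp add: rtr_def p)
  have Im: "(Im (a s))\<^sup>2 = (cmod (b s))\<^sup>2" using *(1)[of s] Re by (simp add: rdet_def p cmod_power2)
  have f0: "f s = 0" using Re by (simp add: f)
  have Re_deriv: "((\<lambda>x. Re (g x)) has_real_derivative Re g') (at x)"
    if "(g has_vector_derivative g') (at x)" for g g' x
    using bounded_linear.has_vector_derivative[OF bounded_linear_Re that]
    by (simp add: has_real_derivative_iff_has_vector_derivative)
  have df: "deriv f = (\<lambda>\<sigma>. C * Re (\<i> * (a \<sigma> * h \<sigma> - b \<sigma> * cnj (k \<sigma>))))"
  proof
    fix \<sigma>
    have "(f has_real_derivative C * (Re (\<i> * (a \<sigma> * h \<sigma> - b \<sigma> * cnj (k \<sigma>))) - 0)) (at \<sigma>)"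
      unfolding f by (intro DERIV_cmult DERIV_diff Re_deriv a DERIV_const)
    then show "deriv f \<sigma> = C * Re (\<i> * (a \<sigma> * h \<sigma> - b \<sigma> * cnj (k \<sigma>)))"
      by (simp add: DERIV_imp_deriv)
  qed
  show ?thesis
  proof (cases "p s = (1, 0)")
    case True
    then have as: "a s = 1" and bs: "b s = 0" by (simp_all add: a_def b_def)
    obtain h' where h': "(h has_real_derivative h') (at s)" using *(2) real_differentiable_def by blast
    obtain k' where k': "(k has_vector_derivative k') (at s)" using *(3) differentiable_def vector_derivative_works by blast
    have hc: "((\<lambda>x. complex_of_real (h x)) has_vector_derivative of_real h') (at s)"
      using has_vector_derivative_of_real h' has_real_derivative_iff_has_vector_derivative by blast
    have d: "((\<lambda>\<sigma>. \<i> * (a \<sigma> * h \<sigma> - b \<sigma> * cnj (k \<sigma>))) has_vector_derivative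
       \<i> * ((a s * of_real h' + \<i> * (a s * h s - b s * cnj (k s)) * h s)
         - (b s * cnj k' + \<i> * (a s * k s - b s * h s) * cnj (k s)))) (at s)"
      by (intro has_vector_derivative_mult_right has_vector_derivative_diff has_vector_derivative_mult
          has_vector_derivative_cnj a b hc k')
    have kk: "cmod (k s) * cmod (k s) = Re (k s) * Re (k s) + Im (k s) * Im (k s)"
      using cmod_power2[of "k s"] by (simp only: power2_eq_square)
    \<comment> \<open>At \<open>a = 1\<close>, \<open>b = 0\<close> the derivative \<open>h'\<close>
      contributes only an imaginary term and \<open>k'\<close> is multiplied by 0, so neither enters
      the second derivative.\<close>
    from DERIV_cmult[OF Re_deriv[OF d], of C, folded df]
    have "deriv (deriv f) s = C * ((cmod (k s))\<^sup>2 - (h s)\<^sup>2)"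
      by (simp add: as bs DERIV_imp_deriv kk power2_eq_square algebra_simps)
    moreover have "(cmod (k s))\<^sup>2 < (h s)\<^sup>2"
      using strict[of s] by (intro power_strict_mono) auto
    ultimately have "deriv (deriv f) s \<noteq> 0" using \<open>C \<noteq> 0\<close> by simp
    moreover have "deriv f s = 0" by (simp add: df as bs)
    ultimately show ?thesis using True root_mult_eq_two[of f s] f0 by simp
  next
    case False
    have "Im (a s) \<noteq> 0"
    proof
      assume "Im (a s) = 0"
      then have "a s = 1" "b s = 0" using Re Im by (simp_all add: complex_eq_iff)
      then show False using False p by simp
    qed
    have "Re (\<i> * (a s * h s - b s * cnj (k s))) = Im (b s * cnj (k s)) - Im (a s) * h s" by simp
    moreover have "\<bar>Im (b s * cnj (k s))\<bar> < \<bar>Im (a s) * h s\<bar>"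
    proof -
      have ab: "cmod (b s) = \<bar>Im (a s)\<bar>" by (rule power2_eq_imp_eq) (use Im in auto)
      have "\<bar>Im (b s * cnj (k s))\<bar> \<le> cmod (b s) * cmod (k s)"
        using abs_Im_le_cmod[of "b s * cnj (k s)"] by (simp only: norm_mult complex_mod_cnj)
      also have "\<dots> < \<bar>Im (a s)\<bar> * h s"
        unfolding ab using strict[of s] \<open>Im (a s) \<noteq> 0\<close> by simp
      also have "\<dots> = \<bar>Im (a s) * h s\<bar>"
        using order_le_less_trans[OF norm_ge_zero strict[of s]] by (simp add: abs_mult)
      finally show ?thesis .
    qed
    ultimately have "deriv f s \<noteq> 0" using \<open>C \<noteq> 0\<close> by (auto simp: df)
    then show ?thesis using False root_mult_eq_one[of f s] f0 by simp
  qed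
qed

section \<open>Polygons with exceptional angles\<close>

lemma sin_eq_0_iff_exceptional:
  assumes "0 < a"
  shows "sin (pi\<^sup>2 / (2 * a)) = 0 \<longleftrightarrow> exceptional a"
proof
  assume "sin (pi\<^sup>2 / (2 * a)) = 0"
  then obtain i :: int where i: "pi\<^sup>2 / (2 * a) = of_int i * pi" by (auto simp: sin_zero_iff_int2)
  have "0 < pi\<^sup>2 / (2 * a)" using assms by simp
  then have "0 < i" unfolding i by (simp add: zero_less_mult_iff)
  moreover have "a = pi / (2 * of_int i)"
    using i assms \<open>0 < i\<close> by (simp add: field_simps power2_eq_square)
  ultimately have "nat i \<ge> 1 \<and> a = pi / (2 * real (nat i))" by simp
  then show "exceptional a" unfolding exceptional_def by blast
next
  assume "exceptional a"
  then obtain k :: nat where "k \<ge> 1" "a = pi / (2 * k)" by (auto simp: exceptional_def)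
  then have "pi\<^sup>2 / (2 * a) = k * pi" by (simp add: power2_eq_square)
  then show "sin (pi\<^sup>2 / (2 * a)) = 0" by simp
qed

lemma
  assumes "exceptional a"
  shows parity_O_cos: "of_int (parity_O a) = cos (pi\<^sup>2 / (2 * a))"
    and parity_O_cases: "parity_O a = 1 \<or> parity_O a = -1"
proof -
  obtain k :: nat where k: "k \<ge> 1" "a = pi / (2 * k)" using assms by (auto simp: exceptional_def)
  have "(THE k::nat. k \<ge> 1 \<and> a = pi / (2 * real k)) = k"
    using k by (intro the_equality) (auto simp: field_simps)
  then have par: "parity_O a = (-1) ^ k" by (simp add: parity_O_def)
  have "pi\<^sup>2 / (2 * a) = pi * k" using k by (simp add: power2_eq_square)
  then show "of_int (parity_O a) = cos (pi\<^sup>2 / (2 * a))" by (simp add: par)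
  show "parity_O a = 1 \<or> parity_O a = -1" by (cases "even k") (simp_all add: par)
qed

text \<open>\<open>Xvec a\<close> is \<open>(x, cnj x) / sqrt 2\<close> for the unimodular number \<open>x = xnum a\<close>.\<close>
definition xnum :: "real \<Rightarrow> complex" where
  "xnum a = (if parity_O a = 1 then cis (- pi / 4) else cis (pi / 4))"

lemma xnum_unit: "xnum a * cnj (xnum a) = 1"
  by (simp add: xnum_def cis_cnj cis_mult)

lemma xnum_nonzero [simp]: "xnum a \<noteq> 0"
  by (simp add: xnum_def)

text \<open>The right-hand side is the second coefficient of \<open>rN a\<close>, so at an
  exceptional angle \<open>rN a = (1, x^2)\<close> with \<open>x\<close> unimodular.\<close>

lemma xnum_square:
  assumes "exceptional a"
  shows "(xnum a)\<^sup>2 = - \<i> * of_real (cos (pi\<^sup>2 / (2 * a)))"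
proof -
  have "cis (- (pi / 2)) = - \<i>" by (simp add: complex_eq_iff)
  then have "(xnum a)\<^sup>2 = - \<i> * of_int (parity_O a)" using parity_O_cases[OF assms]
    by (auto simp: xnum_def power2_eq_square cis_mult)
  then show ?thesis unfolding parity_O_cos[OF assms, symmetric] by simp
qed

text \<open>This is the real inner product of two unit directions, which either coincide or are at
  right angles.\<close>

lemma Re_cnj_xnum_mult:
  assumes "exceptional a" "exceptional b"
  shows "Re (cnj (xnum b) * xnum a) = (if parity_O a = parity_O b then 1 else 0)"
  using parity_O_cases[OF assms(1)] parity_O_cases[OF assms(2)]
  by (auto simp: xnum_def cis_cnj cis_mult cos_45 sin_45)

text \<open>\<open>rmat p\<close> preserves vectors of the form \<open>(z, cnj z)\<close>, and on
  these the Hermitian product is twice the real inner product of the plane; the two factors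
  \<open>sqrt 2\<close> cancel the 2.\<close>

lemma herm_dot_rmat:
  "herm_dot (rmat p *\<^sub>v Xvec a) (Xvec b) = of_real (Re (cnj (xnum b) * ract p (xnum a)))"
proof -
  obtain u v where p: "p = (u, v)" by fastforce
  have X: "dim_vec (Xvec a) = 2" "vec_index (Xvec a) 0 = xnum a / sqrt 2"
    "vec_index (Xvec a) (Suc 0) = cnj (xnum a) / sqrt 2" for a
    by (simp_all add: Xvec_def X_even_def X_odd_def xnum_def cis_cnj vec_of_list_index)
  have "herm_dot (rmat p *\<^sub>v Xvec a) (Xvec b) =
      ((u * xnum a + v * cnj (xnum a)) * cnj (xnum b) + cnj (u * xnum a + v * cnj (xnum a)) * xnum b)
        / (of_real (sqrt 2) * of_real (sqrt 2))"
    by (simp add: herm_dot_def X scalar_prod_def sum_upto_2 rmat_def p field_simps)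
  also have "of_real (sqrt 2) * of_real (sqrt 2) = (2 :: complex)"
    by (metis abs_numeral of_real_mult of_real_numeral real_sqrt_mult_self)
  also have "(u * xnum a + v * cnj (xnum a)) * cnj (xnum b) + cnj (u * xnum a + v * cnj (xnum a)) * xnum b
    = of_real (Re (cnj (xnum b) * ract p (xnum a))) * 2"
    by (simp add: p complex_eq_iff algebra_simps)
  finally show ?thesis by (simp only: nonzero_mult_div_cancel_right[OF zero_neq_numeral[symmetric]])
qed

text \<open>Twice the orthogonal projection onto the real line through
  \<open>xnum a\<close>.\<close>

lemma ract_rN_exceptional:
  assumes "exceptional a"
  shows "ract (rN a) z = of_real (2 * Re (cnj (xnum a) * z)) * xnum a"
proof -
  have "of_real (2 * Re (cnj (xnum a) * z)) = cnj (xnum a) * z + xnum a * cnj z"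
    by (simp add: complex_eq_iff)
  then have "of_real (2 * Re (cnj (xnum a) * z)) * xnum a
    = (xnum a * cnj (xnum a)) * z + (xnum a)\<^sup>2 * cnj z"
    by (simp add: power2_eq_square algebra_simps)
  then show ?thesis unfolding xnum_unit xnum_square[OF assms] by (simp add: rN_def)
qed

text \<open>At an exceptional vertex \<open>rN a\<close> has rank one with image spanned by \<open>xnum a\<close>, so the trace of
  \<open>rN a \<star> q\<close> is its eigenvalue there.\<close>
lemma ract_rN_rcomp_exceptional:
  assumes "exceptional a"
  shows "ract (rN a \<star> q) (xnum a) = of_real (rtr (rN a \<star> q)) * xnum a"
proof -
  obtain u v where q: "q = (u, v)" by fastforce
  have N: "rN a = (1, (xnum a)\<^sup>2)" by (simp add: rN_def xnum_square[OF assms])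
  have "2 * Re (cnj (xnum a) * ract q (xnum a)) = rtr (rN a \<star> q)"
  proof -
    have "cnj (xnum a) * ract q (xnum a) = u * (xnum a * cnj (xnum a)) + v * cnj ((xnum a)\<^sup>2)"
      by (simp add: q power2_eq_square algebra_simps)
    moreover have "Re (v * cnj w) = Re (w * cnj v)" for w by simp
    ultimately have "Re (cnj (xnum a) * ract q (xnum a)) = Re (u + (xnum a)\<^sup>2 * cnj v)"
      unfolding xnum_unit by (simp only: plus_complex.sel mult_1_right)
    then show ?thesis unfolding N by (simp only: q rtr_def rcomp.simps fst_conv mult_1_left)
  qed
  then show ?thesis by (simp only: ract_rcomp ract_rN_exceptional[OF assms])
qed

section \<open>Cyclic indices and the gaps between exceptional vertices\<close>

lemma cidx_range: "n \<ge> 1 \<Longrightarrow> cidx n j \<in> {1..n}"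
  by (simp add: cidx_def Suc_le_eq)

lemma cidx_id: "j \<in> {1..n} \<Longrightarrow> cidx n j = j"
  unfolding cidx_def by (subst mod_less) auto

lemma cidx_cidx_add:
  assumes "1 \<le> p"
  shows "cidx n (cidx n p + j) = cidx n (p + j)"
proof -
  have 1: "p + j - 1 = (p - 1) + j" using assms by simp
  have 2: "cidx n p + j - 1 = (p - 1) mod n + j" by (simp add: cidx_def)
  show ?thesis
    unfolding cidx_def[of n "cidx n p + j"] cidx_def[of n "p + j"] 1 2 mod_add_left_eq ..
qed

lemma cidx_add_n:
  assumes "j \<ge> 1"
  shows "cidx n (j + n) = cidx n j"
proof -
  have "j + n - 1 = (j - 1) + n" using assms by simp
  then show ?thesis by (simp only: cidx_def mod_add_self2)
qed

text \<open>\<open>gap\<close> adds \<open>n\<close> before subtracting, to avoid truncation; for an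
  unreduced index \<open>q > k\<close> the plain difference serves as well.\<close>

lemma cidx_cidx_diff:
  assumes "k \<le> n" "k < q"
  shows "cidx n (cidx n q + n - k) = cidx n (q - k)"
proof -
  have "cidx n q + n - k = cidx n q + (n - k)" using assms by simp
  also have "cidx n \<dots> = cidx n (q + (n - k))"
    using assms by (intro cidx_cidx_add) simp
  also have "q + (n - k) = (q - k) + n" using assms by simp
  also have "cidx n \<dots> = cidx n (q - k)" using assms by (intro cidx_add_n) simp
  finally show ?thesis .
qed

lemma inj_on_cidx: "inj_on (cidx n) {e + 1..e + n}"
proof (rule inj_onI)
  have *: "i = j" if "i \<le> j" "i \<in> {e + 1..e + n}" "j \<in> {e + 1..e + n}" "cidx n i = cidx n j" for i j
  proof (rule ccontr)
    assume "i \<noteq> j"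
    have "(j - 1) mod n = (i - 1) mod n" using that(4) by (simp add: cidx_def)
    moreover have "i - 1 \<le> j - 1" using that(1) by simp
    ultimately have "n dvd (j - 1) - (i - 1)" by (simp only: mod_eq_dvd_iff_nat)
    moreover have "0 < (j - 1) - (i - 1)" "(j - 1) - (i - 1) < n" using that \<open>i \<noteq> j\<close> by auto
    ultimately show False using nat_dvd_not_less by blast
  qed
  show "i = j" if "i \<in> {e + 1..e + n}" "j \<in> {e + 1..e + n}" "cidx n i = cidx n j" for i j
    using *[OF _ that] *[OF _ that(2,1) that(3)[symmetric]] by (metis nat_le_linear)
qed

text \<open>For reindexing a product along one full turn that starts just after \<open>e\<close>:
  vertices above \<open>e\<close> appear as themselves, the others as \<open>m + n\<close>.\<close>

lemma bij_betw_cidx: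
  assumes "n \<ge> 1" "e \<in> {1..n}" "E \<subseteq> {1..n}"
  shows "bij_betw (cidx n) {j \<in> {e + 1..e + n}. cidx n j \<in> E} E"
  unfolding bij_betw_def
proof
  show "inj_on (cidx n) {j \<in> {e + 1..e + n}. cidx n j \<in> E}"
    by (rule inj_on_subset[OF inj_on_cidx]) auto
  have "m \<in> cidx n ` {j \<in> {e + 1..e + n}. cidx n j \<in> E}" if "m \<in> E" for m
  proof -
    have m: "m \<in> {1..n}" using that assms by auto
    show ?thesis
    proof (cases "m > e")
      case True
      then show ?thesis using m that assms(2) by (intro image_eqI[of _ _ m]) (auto simp: cidx_id)
    next
      case False
      then show ?thesis using m that assms(2)
        by (intro image_eqI[of _ _ "m + n"]) (auto simp: cidx_add_n cidx_id)
    qed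
  qed
  then show "cidx n ` {j \<in> {e + 1..e + n}. cidx n j \<in> E} = E" by auto
qed

lemma
  assumes "n \<ge> 1" "e \<in> exc_set n \<alpha>"
  shows gap_ge_1: "1 \<le> gap n \<alpha> e"
    and prev_exc_in: "prev_exc n \<alpha> e \<in> exc_set n \<alpha>"
    and cidx_prev_exc_gap: "cidx n (prev_exc n \<alpha> e + gap n \<alpha> e) = e"
    and no_exc_in_gap: "\<lbrakk>1 \<le> j; j < gap n \<alpha> e\<rbrakk> \<Longrightarrow> cidx n (prev_exc n \<alpha> e + j) \<notin> exc_set n \<alpha>"
proof -
  have e: "e \<in> {1..n}" using assms by (auto simp: exc_set_def)
  let ?P = "\<lambda>k. 1 \<le> k \<and> cidx n (e + n - k) \<in> exc_set n \<alpha>"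
  \<comment> \<open>Going back \<open>n\<close> arcs returns to \<open>e\<close> itself, so the
    least value exists and is at most \<open>n\<close>, even if \<open>e\<close> is the only
    exceptional vertex.\<close>
  have n: "?P n" using assms e cidx_id[OF e] by simp
  from LeastI[of ?P, OF n] have P: "?P (gap n \<alpha> e)" unfolding gap_def .
  then show "1 \<le> gap n \<alpha> e" "prev_exc n \<alpha> e \<in> exc_set n \<alpha>" by (simp_all add: prev_exc_def)
  have le: "gap n \<alpha> e \<le> n" unfolding gap_def by (rule Least_le[of ?P, OF n])
  have shift: "cidx n (prev_exc n \<alpha> e + j) = cidx n (e + n - (gap n \<alpha> e - j))" if "j \<le> gap n \<alpha> e" for j
  proof -
    have "1 \<le> e + n - gap n \<alpha> e" using le e by auto
    from cidx_cidx_add[OF this] show ?thesis using le that by (simp add: prev_exc_def)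
  qed
  show "cidx n (prev_exc n \<alpha> e + gap n \<alpha> e) = e"
    using shift[of "gap n \<alpha> e"] e by (simp add: cidx_add_n cidx_id)
  show "cidx n (prev_exc n \<alpha> e + j) \<notin> exc_set n \<alpha>" if "1 \<le> j" "j < gap n \<alpha> e"
  proof -
    have "gap n \<alpha> e - j < gap n \<alpha> e" using that by simp
    then have "\<not> ?P (gap n \<alpha> e - j)" unfolding gap_def by (rule not_less_Least)
    then show ?thesis using shift[of j] that by simp
  qed
qed

text \<open>The definition of \<open>gap\<close> searches backwards from a vertex; here the walk
  goes forwards from the exceptional vertex at the unreduced index \<open>p\<close>, and
  \<open>r < n\<close> keeps it within one turn.\<close>

lemma
  assumes "1 \<le> p" "r < n" "cidx n p \<in> exc_set n \<alpha>"
    and "\<And>j. 1 \<le> j \<Longrightarrow> j \<le> r \<Longrightarrow> cidx n (p + j) \<notin> exc_set n \<alpha>"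
  shows gap_eqI: "gap n \<alpha> (cidx n (p + Suc r)) = Suc r"
    and prev_exc_eqI: "prev_exc n \<alpha> (cidx n (p + Suc r)) = cidx n p"
proof -
  have shift: "cidx n (cidx n (p + Suc r) + n - k) = cidx n (p + Suc r - k)" if "k \<le> Suc r" for k
    using that assms by (intro cidx_cidx_diff) auto
  show gap: "gap n \<alpha> (cidx n (p + Suc r)) = Suc r"
    unfolding gap_def
  proof (rule Least_equality)
    show "1 \<le> Suc r \<and> cidx n (cidx n (p + Suc r) + n - Suc r) \<in> exc_set n \<alpha>"
      using shift[of "Suc r"] assms by simp
    show "Suc r \<le> k" if "1 \<le> k \<and> cidx n (cidx n (p + Suc r) + n - k) \<in> exc_set n \<alpha>" for k
    proof (rule ccontr)
      assume "\<not> Suc r \<le> k"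
      then have "cidx n (p + (Suc r - k)) \<in> exc_set n \<alpha>" using that shift[of k] by simp
      moreover have "1 \<le> Suc r - k" "Suc r - k \<le> r" using that \<open>\<not> Suc r \<le> k\<close> by auto
      ultimately show False using assms(4) by blast
    qed
  qed
  show "prev_exc n \<alpha> (cidx n (p + Suc r)) = cidx n p"
    unfolding prev_exc_def gap using shift[of "Suc r"] by simp
qed

text \<open>Unlike \<open>seg\<close>, the product \<open>Uprod\<close> ends with
  \<open>matB\<close>, without the matrix of the final vertex, so one \<open>rB\<close> is split off
  on the left.\<close>

lemma Uprod_Suc_eq_rmat:
  "Uprod n \<alpha> ell \<sigma> p (Suc t) =
    rmat (rB (ell (cidx n (p + Suc t))) \<sigma> \<star> seg (\<lambda>j. rA (\<alpha> (cidx n j)) \<star> rB (ell (cidx n j)) \<sigma>) p t)"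
proof (induction t)
  case 0
  then show ?case by (simp add: rmat_rB)
next
  case (Suc t)
  then show ?case by (simp add: rmat_rA rmat_rB rmat_mult rcomp_assoc)
qed

text \<open>The solution leaving the exceptional vertex before \<open>e\<close> in direction \<open>xnum\<close>, and its
  component along \<open>xnum\<close> on arrival at \<open>e\<close>.\<close>
definition exc_sol :: "nat \<Rightarrow> (nat \<Rightarrow> real) \<Rightarrow> (nat \<Rightarrow> real) \<Rightarrow> nat \<Rightarrow> real \<Rightarrow> complex" where
  "exc_sol n \<alpha> ell e \<sigma> = ract (rB (ell e) \<sigma> \<star>
     seg (\<lambda>j. rA (\<alpha> (cidx n j)) \<star> rB (ell (cidx n j)) \<sigma>) (prev_exc n \<alpha> e) (gap n \<alpha> e - 1))
     (xnum (\<alpha> (prev_exc n \<alpha> e)))"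

definition exc_fun :: "nat \<Rightarrow> (nat \<Rightarrow> real) \<Rightarrow> (nat \<Rightarrow> real) \<Rightarrow> nat \<Rightarrow> real \<Rightarrow> real" where
  "exc_fun n \<alpha> ell e \<sigma> = Re (cnj (xnum (\<alpha> e)) * exc_sol n \<alpha> ell e \<sigma>)"

lemma good_exc_eq:
  assumes "n \<ge> 1"
  shows "good_exc n \<alpha> ell \<sigma> = {e \<in> exc_set n \<alpha>. exc_fun n \<alpha> ell e \<sigma> = 0}"
proof -
  have "herm_dot (matU n \<alpha> ell \<sigma> e *\<^sub>v Xvec (\<alpha> (prev_exc n \<alpha> e))) (Xvec (\<alpha> e))
    = of_real (exc_fun n \<alpha> ell e \<sigma>)" if "e \<in> exc_set n \<alpha>" for e
  proof -
    have "matU n \<alpha> ell \<sigma> e = rmat (rB (ell e) \<sigma> \<star>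
     seg (\<lambda>j. rA (\<alpha> (cidx n j)) \<star> rB (ell (cidx n j)) \<sigma>) (prev_exc n \<alpha> e) (gap n \<alpha> e - 1))"
      using Uprod_Suc_eq_rmat[of n \<alpha> ell \<sigma> "prev_exc n \<alpha> e" "gap n \<alpha> e - 1"]
        gap_ge_1[OF assms that] cidx_prev_exc_gap[OF assms that] by (simp add: matU_def)
    then show ?thesis by (simp only: herm_dot_rmat exc_fun_def exc_sol_def)
  qed
  then show ?thesis by (auto simp: good_exc_def)
qed

lemma seg_rN_eq:
  assumes "\<And>j. 1 \<le> j \<Longrightarrow> j \<le> r \<Longrightarrow> sin (pi\<^sup>2 / (2 * \<alpha> (cidx n (p + j)))) \<noteq> 0"
  shows "seg (\<lambda>j. rN (\<alpha> (cidx n j)) \<star> rB (ell (cidx n j)) \<sigma>) p r =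
    (\<Prod>j=1..r. sin (pi\<^sup>2 / (2 * \<alpha> (cidx n (p + j))))) *\<^sub>R
      seg (\<lambda>j. rA (\<alpha> (cidx n j)) \<star> rB (ell (cidx n j)) \<sigma>) p r"
  using assms
proof (induction r)
  case (Suc r)
  then have "rN (\<alpha> (cidx n (p + Suc r))) = sin (pi\<^sup>2 / (2 * \<alpha> (cidx n (p + Suc r)))) *\<^sub>R rA (\<alpha> (cidx n (p + Suc r)))"
    using Suc.prems[of "Suc r"] by (intro rN_eq) simp
  with Suc show ?case
    by (simp add: rcomp_scaleR mult_ac)
qed simp

section \<open>Curves turning counterclockwise\<close>

definition rotating :: "(real \<Rightarrow> complex) \<Rightarrow> bool" where
  "rotating z \<longleftrightarrow> smooth (\<lambda>\<sigma>. Re (z \<sigma>)) \<and> smooth (\<lambda>\<sigma>. Im (z \<sigma>)) \<and>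
    (\<forall>\<sigma>. z \<sigma> \<noteq> 0 \<and> (\<exists>z'. (z has_vector_derivative z') (at \<sigma>) \<and> 0 \<le> Im (cnj (z \<sigma>) * z')))"

lemma smooth_linear: "smooth f \<Longrightarrow> smooth g \<Longrightarrow> smooth (\<lambda>x. c * f x + d * g x)"
  by (intro smooth_add smooth_mult smooth_const)

lemma rotating_const: "c \<noteq> 0 \<Longrightarrow> rotating (\<lambda>\<sigma>. c)"
  by (auto simp: rotating_def smooth_const intro!: exI[of _ 0])

text \<open>\<open>Im (cnj z * z')\<close> is the squared modulus of \<open>z\<close> times its
  angular velocity. As an area form it is scaled by the determinant under a real-linear map, so
  determinant 1 preserves it.\<close>

lemma rotating_rA:
  assumes "rotating z" "rdet q = 1"
  shows "rotating (\<lambda>\<sigma>. ract q (z \<sigma>))"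
proof -
  obtain u v where q: "q = (u, v)" by fastforce
  have det: "(cmod u)\<^sup>2 - (cmod v)\<^sup>2 = 1" using assms(2) by (simp add: rdet_def q)
  have s: "smooth (\<lambda>\<sigma>. Re (z \<sigma>))" "smooth (\<lambda>\<sigma>. Im (z \<sigma>))" using assms(1) by (simp_all add: rotating_def)
  have "Re (ract q w) = (Re u + Re v) * Re w + (Im v - Im u) * Im w"
    and "Im (ract q w) = (Im u + Im v) * Re w + (Re u - Re v) * Im w" for w
    by (simp_all add: q algebra_simps)
  then have "smooth (\<lambda>\<sigma>. Re (ract q (z \<sigma>)))" "smooth (\<lambda>\<sigma>. Im (ract q (z \<sigma>)))"
    using smooth_linear[OF s] by simp_all
  moreover have "ract q (z \<sigma>) \<noteq> 0
    \<and> (\<exists>z'. ((\<lambda>\<sigma>. ract q (z \<sigma>)) has_vector_derivative z') (at \<sigma>) \<and> 0 \<le> Im (cnj (ract q (z \<sigma>)) * z'))" for \<sigma>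
  proof -
    from assms(1) obtain z' where z: "z \<sigma> \<noteq> 0" "(z has_vector_derivative z') (at \<sigma>)" "0 \<le> Im (cnj (z \<sigma>) * z')"
      by (auto simp: rotating_def)
    have "ract q (z \<sigma>) \<noteq> 0"
    proof
      assume "ract q (z \<sigma>) = 0"
      then have "u * z \<sigma> = - (v * cnj (z \<sigma>))" by (simp add: q add_eq_0_iff2)
      then have "cmod (u * z \<sigma>) = cmod (v * cnj (z \<sigma>))" by (simp only: norm_minus_cancel)
      then have "cmod u = cmod v" using z(1) by (simp add: norm_mult)
      then show False using det by simp
    qed
    moreover have "((\<lambda>\<sigma>. ract q (z \<sigma>)) has_vector_derivative ract q z') (at \<sigma>)"
      unfolding q ract.simps
      by (rule has_vector_derivative_add[OF has_vector_derivative_mult_right[OF z(2)]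
            has_vector_derivative_mult_right[OF has_vector_derivative_cnj[OF z(2)]]])
    moreover have "Im (cnj (ract q (z \<sigma>)) * ract q z') = ((cmod u)\<^sup>2 - (cmod v)\<^sup>2) * Im (cnj (z \<sigma>) * z')"
      unfolding cmod_power2 by (simp add: q power2_eq_square algebra_simps)
    ultimately show ?thesis using det z(3) by auto
  qed
  ultimately show ?thesis unfolding rotating_def by blast
qed

text \<open>The rotation by \<open>l * \<sigma>\<close> adds \<open>l > 0\<close> to the angular
  velocity, which makes it strictly positive.\<close>

lemma
  assumes "rotating z" "l > 0"
  shows rotating_rB: "rotating (\<lambda>\<sigma>. ract (rB l \<sigma>) (z \<sigma>))"
    and rotating_rB_strict:
      "\<exists>z'. ((\<lambda>\<sigma>. ract (rB l \<sigma>) (z \<sigma>)) has_vector_derivative z') (at \<sigma>) \<and> 0 < Im (cnj (ract (rB l \<sigma>) (z \<sigma>)) * z')"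
proof -
  have B: "ract (rB l \<sigma>) w = cis (l * \<sigma>) * w" for \<sigma> w by (simp add: rB_def)
  show strict: "\<exists>z'. ((\<lambda>\<sigma>. ract (rB l \<sigma>) (z \<sigma>)) has_vector_derivative z') (at \<sigma>)
      \<and> 0 < Im (cnj (ract (rB l \<sigma>) (z \<sigma>)) * z')" for \<sigma>
  proof -
    from assms(1) obtain z' where z: "z \<sigma> \<noteq> 0" "(z has_vector_derivative z') (at \<sigma>)" "0 \<le> Im (cnj (z \<sigma>) * z')"
      by (auto simp: rotating_def)
    let ?z' = "cis (l * \<sigma>) * (\<i> * l * z \<sigma> + z')"
    have "cnj (cis (l * \<sigma>) * z \<sigma>) * ?z' = (cnj (cis (l * \<sigma>)) * cis (l * \<sigma>)) * (cnj (z \<sigma>) * (\<i> * l * z \<sigma> + z'))"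
      by (simp add: mult_ac)
    also have "\<dots> = \<i> * l * (z \<sigma> * cnj (z \<sigma>)) + cnj (z \<sigma>) * z'"
      by (simp add: cis_cnj cis_mult algebra_simps)
    finally have "Im (cnj (cis (l * \<sigma>) * z \<sigma>) * ?z') = l * (cmod (z \<sigma>))\<^sup>2 + Im (cnj (z \<sigma>) * z')"
      by (simp only: complex_norm_square[symmetric]) simp
    moreover have "0 < l * (cmod (z \<sigma>))\<^sup>2" using assms(2) z(1) by simp
    ultimately have "0 < Im (cnj (cis (l * \<sigma>) * z \<sigma>) * ?z')" using z(3) by simp
    then show ?thesis unfolding B using has_vector_derivative_cis_mult[OF z(2), of l] by blast
  qed
  have s: "smooth (\<lambda>\<sigma>. Re (z \<sigma>))" "smooth (\<lambda>\<sigma>. Im (z \<sigma>))" using assms(1) by (simp_all add: rotating_def)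
  have c: "smooth (\<lambda>\<sigma>. cos (l * \<sigma>))" using smooth_cos[of l 0] by simp
  have "smooth (\<lambda>\<sigma>. cos (l * \<sigma>) * Re (z \<sigma>) + (-1) * (sin (l * \<sigma>) * Im (z \<sigma>)))"
    by (intro smooth_add smooth_mult smooth_const smooth_sin c s)
  moreover have "smooth (\<lambda>\<sigma>. cos (l * \<sigma>) * Im (z \<sigma>) + sin (l * \<sigma>) * Re (z \<sigma>))"
    by (intro smooth_add smooth_mult smooth_sin c s)
  ultimately have "smooth (\<lambda>\<sigma>. Re (ract (rB l \<sigma>) (z \<sigma>)))" "smooth (\<lambda>\<sigma>. Im (ract (rB l \<sigma>) (z \<sigma>)))"
    by (simp_all add: B)
  moreover have "ract (rB l \<sigma>) (z \<sigma>) \<noteq> 0" for \<sigma> using assms(1) by (simp add: B rotating_def)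
  ultimately show "rotating (\<lambda>\<sigma>. ract (rB l \<sigma>) (z \<sigma>))"
    unfolding rotating_def using strict less_imp_le by blast
qed

lemma rotating_seg:
  assumes "\<And>j. 1 \<le> j \<Longrightarrow> j \<le> t \<Longrightarrow> rdet (A (p + j)) = 1 \<and> 0 < l (p + j)" "x \<noteq> 0"
  shows "rotating (\<lambda>\<sigma>. ract (seg (\<lambda>j. A j \<star> rB (l j) \<sigma>) p t) x)"
  using assms(1)
proof (induction t)
  case 0
  then show ?case using rotating_const[OF assms(2)] by simp
next
  case (Suc t)
  then have IH: "rotating (\<lambda>\<sigma>. ract (seg (\<lambda>j. A j \<star> rB (l j) \<sigma>) p t) x)" by simp
  have "rdet (A (p + Suc t)) = 1" "0 < l (p + Suc t)" using Suc.prems[of "Suc t"] by simp_all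
  from rotating_rA[OF rotating_rB[OF IH this(2)] this(1)] show ?case
    by (simp only: seg.simps ract_rcomp)
qed

text \<open>\<open>z\<close> turns counterclockwise, so it crosses the line orthogonal to \<open>x\<close> transversally.\<close>
lemma deriv_Re_cnj_mult_nonzero:
  assumes "(z has_vector_derivative z') (at \<sigma>)" "0 < Im (cnj (z \<sigma>) * z')" "x * cnj x = 1"
    and "Re (cnj x * z \<sigma>) = 0"
  shows "deriv (\<lambda>\<sigma>. Re (cnj x * z \<sigma>)) \<sigma> \<noteq> 0"
proof -
  have "((\<lambda>\<sigma>. Re (cnj x * z \<sigma>)) has_real_derivative Re (cnj x * z')) (at \<sigma>)"
    unfolding has_real_derivative_iff_has_vector_derivative
    by (rule bounded_linear.has_vector_derivative[OF bounded_linear_Re has_vector_derivative_mult_right[OF assms(1)]])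
  then have "deriv (\<lambda>\<sigma>. Re (cnj x * z \<sigma>)) \<sigma> = Re (cnj x * z')" by (rule DERIV_imp_deriv)
  moreover have "Re (cnj x * z') \<noteq> 0"
  proof
    assume 0: "Re (cnj x * z') = 0"
    have "cnj (z \<sigma>) * z' = (x * cnj x) * (cnj (z \<sigma>) * z')" unfolding assms(3) by simp
    also have "\<dots> = cnj (cnj x * z \<sigma>) * (cnj x * z')" by (simp add: mult_ac)
    also have "Im \<dots> = Re (cnj x * z \<sigma>) * Im (cnj x * z') - Im (cnj x * z \<sigma>) * Re (cnj x * z')"
      by (simp only: times_complex.sel cnj.sel)
    finally show False using assms(2,4) 0 by simp
  qed
  ultimately show ?thesis by simp
qed

section \<open>Simple zeros and factorization over the exceptional vertices\<close>

context
  fixes n :: nat and \<alpha> ell :: "nat \<Rightarrow> real"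
  assumes n: "n \<ge> 1"
    and \<alpha>: "\<And>j. j \<in> {1..n} \<Longrightarrow> 0 < \<alpha> j"
    and ell: "\<And>j. j \<in> {1..n} \<Longrightarrow> 0 < ell j"
begin

lemma sin_nonzero_cidx:
  "cidx n j \<notin> exc_set n \<alpha> \<Longrightarrow> sin (pi\<^sup>2 / (2 * \<alpha> (cidx n j))) \<noteq> 0"
  using sin_eq_0_iff_exceptional[OF \<alpha>[OF cidx_range[OF n]]] cidx_range[OF n] by (auto simp: exc_set_def)

text \<open>The last factor applied in \<open>exc_sol\<close> is \<open>rB (ell e)\<close>, so the
  solution turns strictly even when no vertex lies inside the gap; hence all zeros are
  simple.\<close>

lemma
  assumes e: "e \<in> exc_set n \<alpha>"
  shows smooth_exc_fun: "smooth (exc_fun n \<alpha> ell e)"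
    and deriv_exc_fun: "exc_fun n \<alpha> ell e \<sigma> = 0 \<Longrightarrow> deriv (exc_fun n \<alpha> ell e) \<sigma> \<noteq> 0"
proof -
  have l: "0 < ell e" using e ell by (simp add: exc_set_def)
  let ?p = "prev_exc n \<alpha> e"
  let ?z = "\<lambda>\<sigma>. ract (seg (\<lambda>j. rA (\<alpha> (cidx n j)) \<star> rB (ell (cidx n j)) \<sigma>) ?p (gap n \<alpha> e - 1)) (xnum (\<alpha> ?p))"
  have "rotating ?z"
  proof (rule rotating_seg[where A = "\<lambda>j. rA (\<alpha> (cidx n j))" and l = "\<lambda>j. ell (cidx n j)"])
    fix j assume "1 \<le> j" "j \<le> gap n \<alpha> e - 1"
    then have "cidx n (?p + j) \<notin> exc_set n \<alpha>" using no_exc_in_gap[OF n e] by simp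
    then show "rdet (rA (\<alpha> (cidx n (?p + j)))) = 1 \<and> 0 < ell (cidx n (?p + j))"
      using sin_nonzero_cidx rdet_rA ell[OF cidx_range[OF n]] by blast
  qed simp
  note z = this
  have sol: "exc_sol n \<alpha> ell e = (\<lambda>\<sigma>. ract (rB (ell e) \<sigma>) (?z \<sigma>))"
    by (simp only: exc_sol_def ract_rcomp fun_eq_iff) simp
  have rot: "rotating (exc_sol n \<alpha> ell e)" unfolding sol by (rule rotating_rB[OF z l])
  have fn: "exc_fun n \<alpha> ell e = (\<lambda>\<sigma>. Re (cnj (xnum (\<alpha> e)) * exc_sol n \<alpha> ell e \<sigma>))"
    by (simp only: exc_fun_def fun_eq_iff) simp
  have s: "smooth (\<lambda>\<sigma>. Re (exc_sol n \<alpha> ell e \<sigma>))" "smooth (\<lambda>\<sigma>. Im (exc_sol n \<alpha> ell e \<sigma>))"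
    using rot by (simp_all add: rotating_def)
  from smooth_linear[OF this, of "Re (xnum (\<alpha> e))" "Im (xnum (\<alpha> e))"]
  show "smooth (exc_fun n \<alpha> ell e)" unfolding fn by simp
  show "deriv (exc_fun n \<alpha> ell e) \<sigma> \<noteq> 0" if "exc_fun n \<alpha> ell e \<sigma> = 0"
  proof -
    obtain z' where "(exc_sol n \<alpha> ell e has_vector_derivative z') (at \<sigma>)"
      "0 < Im (cnj (exc_sol n \<alpha> ell e \<sigma>) * z')"
      using rotating_rB_strict[OF z l, of \<sigma>] unfolding sol by blast
    from deriv_Re_cnj_mult_nonzero[OF this xnum_unit] that show ?thesis unfolding fn by blast
  qed
qed

text \<open>The direction \<open>xnum b\<close> is an eigenvector of every \<open>rA a\<close>,
  because \<open>- \<i> * cnj (xnum b)\<close> is plus or minus \<open>xnum b\<close>.\<close>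

lemma ract_rA_xnum:
  assumes "exceptional b" "sin (pi\<^sup>2 / (2 * a)) \<noteq> 0"
  shows "\<exists>r. r \<noteq> 0 \<and> ract (rA a) (xnum b) = of_real r * xnum b"
proof -
  define t where "t = pi\<^sup>2 / (2 * a)"
  define d :: real where "d = of_int (parity_O b)"
  have d: "d * d = 1" using parity_O_cases[OF assms(1)] by (auto simp: d_def)
  have "- \<i> * cnj (xnum b) = (- \<i> * cnj (xnum b)) * (d * d)" unfolding d by simp
  also have "\<dots> = ((xnum b)\<^sup>2 * cnj (xnum b)) * d"
    unfolding xnum_square[OF assms(1)] by (simp add: d_def parity_O_cos[OF assms(1)])
  also have "(xnum b)\<^sup>2 * cnj (xnum b) = xnum b * (xnum b * cnj (xnum b))" by (simp add: power2_eq_square)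
  finally have x: "- \<i> * cnj (xnum b) = xnum b * d" unfolding xnum_unit by simp
  have "ract (rA a) (xnum b) = of_real (1 / sin t) * xnum b + of_real (cot t) * (- \<i> * cnj (xnum b))"
    by (simp add: rA_def t_def Let_def)
  also have "\<dots> = of_real (1 / sin t + cot t * d) * xnum b"
    unfolding x by (simp add: algebra_simps)
  finally have 1: "ract (rA a) (xnum b) = of_real (1 / sin t + cot t * d) * xnum b" .
  \<comment> \<open>The eigenvalue is nonzero because it divides the determinant 1.\<close>
  have "(1 / sin t + cot t * d) * (1 / sin t - cot t * d) = (1 / sin t)\<^sup>2 - (cot t)\<^sup>2 * (d * d)"
    by (simp add: power2_eq_square algebra_simps)
  also have "\<dots> = rdet (rA a)"
    unfolding d by (simp add: rdet_def rA_def t_def Let_def norm_mult norm_divide power_divide)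
  also have "\<dots> = 1" by (rule rdet_rA[OF assms(2)])
  finally have "1 / sin t + cot t * d \<noteq> 0" by auto
  with 1 show ?thesis by blast
qed

text \<open>At 0 every \<open>rB\<close> is the identity and every \<open>rA\<close> preserves the
  starting line, so the solution arrives in its initial direction and only the angle between the two
  \<open>xnum\<close> directions matters.\<close>

lemma exc_fun_0:
  assumes e: "e \<in> exc_set n \<alpha>"
  shows "exc_fun n \<alpha> ell e 0 = 0 \<longleftrightarrow> parity_O (\<alpha> (prev_exc n \<alpha> e)) \<noteq> parity_O (\<alpha> e)"
proof -
  let ?p = "prev_exc n \<alpha> e"
  have exc: "exceptional (\<alpha> ?p)" "exceptional (\<alpha> e)"
    using prev_exc_in[OF n e] e by (simp_all add: exc_set_def)
  have B: "rB l 0 = (1, 0)" for l by (simp add: rB_def)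
  have "\<exists>r. r \<noteq> 0 \<and> ract (seg (\<lambda>j. rA (\<alpha> (cidx n j)) \<star> rB (ell (cidx n j)) 0) ?p t) (xnum (\<alpha> ?p))
      = of_real r * xnum (\<alpha> ?p)" if "t < gap n \<alpha> e" for t
    using that
  proof (induction t)
    case 0
    then show ?case by (intro exI[of _ 1]) simp
  next
    case (Suc t)
    then obtain r where r: "r \<noteq> 0" "ract (seg (\<lambda>j. rA (\<alpha> (cidx n j)) \<star> rB (ell (cidx n j)) 0) ?p t) (xnum (\<alpha> ?p))
      = of_real r * xnum (\<alpha> ?p)" by auto
    have "cidx n (?p + Suc t) \<notin> exc_set n \<alpha>" using Suc.prems by (intro no_exc_in_gap[OF n e]) simp_all
    from ract_rA_xnum[OF exc(1) sin_nonzero_cidx[OF this]] obtain r' where r':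
      "r' \<noteq> 0" "ract (rA (\<alpha> (cidx n (?p + Suc t)))) (xnum (\<alpha> ?p)) = of_real r' * xnum (\<alpha> ?p)" by blast
    have "ract (seg (\<lambda>j. rA (\<alpha> (cidx n j)) \<star> rB (ell (cidx n j)) 0) ?p (Suc t)) (xnum (\<alpha> ?p))
      = of_real (r * r') * xnum (\<alpha> ?p)"
      by (simp only: seg.simps ract_rcomp r ract_real_mult) (simp only: B ract_one r' of_real_mult mult.assoc)
    then show ?case using r r' by (intro exI[of _ "r * r'"]) simp
  qed
  from this[of "gap n \<alpha> e - 1"] gap_ge_1[OF n e] obtain r where
    r: "r \<noteq> 0" "exc_sol n \<alpha> ell e 0 = of_real r * xnum (\<alpha> ?p)" by (auto simp: exc_sol_def B)
  have "exc_fun n \<alpha> ell e 0 = r * Re (cnj (xnum (\<alpha> e)) * xnum (\<alpha> ?p))"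
    by (simp add: exc_fun_def r(2) algebra_simps)
  then show ?thesis using r(1) Re_cnj_xnum_mult[OF exc] by simp
qed

text \<open>Invariant of the walk of \<open>k\<close> arcs from \<open>e\<close>: \<open>p\<close>
  is the last exceptional vertex reached, as an unreduced index, and \<open>r\<close> counts the
  arcs since then. Each new exceptional vertex projects the solution onto its own direction, which
  splits off one \<open>exc_fun\<close> and restarts the walk there.\<close>

lemma seg_factor:
  assumes e: "e \<in> exc_set n \<alpha>" and "k \<le> n"
  defines "N \<equiv> \<lambda>\<sigma> j. rN (\<alpha> (cidx n j)) \<star> rB (ell (cidx n j)) \<sigma>"
  shows "\<exists>p r c. e + k = p + r \<and> e \<le> p \<and> cidx n p \<in> exc_set n \<alpha> \<and> c \<noteq> 0
     \<and> (\<forall>j. 1 \<le> j \<longrightarrow> j \<le> r \<longrightarrow> cidx n (p + j) \<notin> exc_set n \<alpha>)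
     \<and> (\<forall>\<sigma>. ract (seg (N \<sigma>) e k) (xnum (\<alpha> e)) =
          of_real (c * (\<Prod>j\<in>{j \<in> {e + 1..e + k}. cidx n j \<in> exc_set n \<alpha>}. exc_fun n \<alpha> ell (cidx n j) \<sigma>))
            * ract (seg (N \<sigma>) p r) (xnum (\<alpha> (cidx n p))))"
  using assms(2)
proof (induction k)
  case 0
  have "cidx n e = e" using e by (intro cidx_id) (simp add: exc_set_def)
  then show ?case using e by (intro exI[of _ e] exI[of _ 0] exI[of _ 1]) simp
next
  case (Suc k)
  then obtain p r c where pr: "e + k = p + r" "e \<le> p" "cidx n p \<in> exc_set n \<alpha>" "c \<noteq> 0"
    and no: "\<And>j. 1 \<le> j \<Longrightarrow> j \<le> r \<Longrightarrow> cidx n (p + j) \<notin> exc_set n \<alpha>"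
    and IH: "\<And>\<sigma>. ract (seg (N \<sigma>) e k) (xnum (\<alpha> e)) =
          of_real (c * (\<Prod>j\<in>{j \<in> {e + 1..e + k}. cidx n j \<in> exc_set n \<alpha>}. exc_fun n \<alpha> ell (cidx n j) \<sigma>))
            * ract (seg (N \<sigma>) p r) (xnum (\<alpha> (cidx n p)))" by auto
  let ?J = "\<lambda>k. {j \<in> {e + 1..e + k}. cidx n j \<in> exc_set n \<alpha>}"
  let ?q = "p + Suc r"
  have q: "e + Suc k = ?q" using pr(1) by simp
  have step: "ract (seg (N \<sigma>) e (Suc k)) (xnum (\<alpha> e)) =
      of_real (c * (\<Prod>j\<in>?J k. exc_fun n \<alpha> ell (cidx n j) \<sigma>))
            * ract (seg (N \<sigma>) p (Suc r)) (xnum (\<alpha> (cidx n p)))" for \<sigma>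
    by (simp only: seg.simps ract_rcomp IH ract_real_mult q)
  show ?case
  proof (cases "cidx n ?q \<in> exc_set n \<alpha>")
    case False
    then have J: "?J (Suc k) = ?J k" using q by (auto simp: le_Suc_eq)
    have "cidx n (p + j) \<notin> exc_set n \<alpha>" if "1 \<le> j" "j \<le> Suc r" for j
      using that no False by (cases "j = Suc r") auto
    with step[folded J] q pr show ?thesis by (intro exI[of _ p] exI[of _ "Suc r"] exI[of _ c]) blast
  next
    case True
    have "?J (Suc k) = insert ?q (?J k)" using q True by (auto simp: le_Suc_eq)
    moreover have "?q \<notin> ?J k" using q by simp
    ultimately have J: "(\<Prod>j\<in>?J (Suc k). exc_fun n \<alpha> ell (cidx n j) \<sigma>) =
        exc_fun n \<alpha> ell (cidx n ?q) \<sigma> * (\<Prod>j\<in>?J k. exc_fun n \<alpha> ell (cidx n j) \<sigma>)" for \<sigma>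
      by simp
    have e1: "1 \<le> e" using e by (simp add: exc_set_def)
    then have p1: "1 \<le> p" and rn: "r < n" using pr(1,2) Suc.prems by auto
    note gap = gap_eqI[OF p1 rn pr(3) no] and prev = prev_exc_eqI[OF p1 rn pr(3) no]
    \<comment> \<open>The sines cleared since the last exceptional vertex; they are the ratio
      between the \<open>rN\<close> product and the \<open>rA\<close> product in
      \<open>exc_sol\<close>.\<close>
    define S where "S = (\<Prod>j=1..r. sin (pi\<^sup>2 / (2 * \<alpha> (cidx n (p + j)))))"
    have "S \<noteq> 0" unfolding S_def using sin_nonzero_cidx[OF no] by simp
    have sol: "ract (rB (ell (cidx n ?q)) \<sigma>) (ract (seg (N \<sigma>) p r) (xnum (\<alpha> (cidx n p))))
        = of_real S * exc_sol n \<alpha> ell (cidx n ?q) \<sigma>" for \<sigma>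
    proof -
      have "seg (N \<sigma>) p r = S *\<^sub>R seg (\<lambda>j. rA (\<alpha> (cidx n j)) \<star> rB (ell (cidx n j)) \<sigma>) p r"
        unfolding N_def S_def by (rule seg_rN_eq) (rule sin_nonzero_cidx[OF no])
      also have "seg (\<lambda>j. rA (\<alpha> (cidx n j)) \<star> rB (ell (cidx n j)) \<sigma>) p r
          = seg (\<lambda>j. rA (\<alpha> (cidx n j)) \<star> rB (ell (cidx n j)) \<sigma>) (cidx n p) r"
        by (rule seg_cong) (simp only: cidx_cidx_add[OF p1])
      finally show ?thesis
        by (simp only: exc_sol_def gap prev diff_Suc_1 ract_scaleR ract_real_mult ract_rcomp)
    qed
    have N: "ract (N \<sigma> ?q) w = of_real (2 * Re (cnj (xnum (\<alpha> (cidx n ?q))) * ract (rB (ell (cidx n ?q)) \<sigma>) w))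
        * xnum (\<alpha> (cidx n ?q))" for \<sigma> w
      unfolding N_def ract_rcomp by (rule ract_rN_exceptional) (use True in \<open>simp add: exc_set_def\<close>)
    have "ract (seg (N \<sigma>) p (Suc r)) (xnum (\<alpha> (cidx n p)))
        = of_real (2 * S * exc_fun n \<alpha> ell (cidx n ?q) \<sigma>) * xnum (\<alpha> (cidx n ?q))" for \<sigma>
    proof -
      have "Re (cnj x * (of_real S * y)) = S * Re (cnj x * y)" for x y
        by (simp add: algebra_simps)
      then show ?thesis by (simp only: seg.simps ract_rcomp N sol exc_fun_def mult.assoc)
    qed
    then have "ract (seg (N \<sigma>) e (Suc k)) (xnum (\<alpha> e)) =
        of_real ((2 * S * c) * (\<Prod>j\<in>?J (Suc k). exc_fun n \<alpha> ell (cidx n j) \<sigma>))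
          * ract (seg (N \<sigma>) ?q 0) (xnum (\<alpha> (cidx n ?q)))" for \<sigma>
      unfolding step J by (simp add: mult_ac)
    moreover have "2 * S * c \<noteq> 0" using \<open>S \<noteq> 0\<close> pr(4) by simp
    moreover have "e \<le> ?q" using pr(2) by simp
    ultimately show ?thesis using q True
      by (intro exI[of _ ?q] exI[of _ 0] exI[of _ "2 * S * c"]) (simp del: seg.simps)
  qed
qed

text \<open>After a full turn the walk is back at \<open>e\<close>, so
  \<open>xnum (\<alpha> e)\<close> is an eigenvector of the closed product; by rank one its
  eigenvalue is the trace. The product of sines in \<open>FP\<close> vanishes.\<close>

lemma FP_factor:
  assumes "exc_set n \<alpha> \<noteq> {}"
  shows "\<exists>c. c \<noteq> 0 \<and> FP n \<alpha> ell = (\<lambda>\<sigma>. c * (\<Prod>e\<in>exc_set n \<alpha>. exc_fun n \<alpha> ell e \<sigma>))"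
proof -
  obtain e where e: "e \<in> exc_set n \<alpha>" using assms by blast
  then have en: "e \<in> {1..n}" and exc: "exceptional (\<alpha> e)" by (simp_all add: exc_set_def)
  define N where "N \<sigma> j = rN (\<alpha> (cidx n j)) \<star> rB (ell (cidx n j)) \<sigma>" for \<sigma> j
  have ce: "cidx n (e + n) = e" using en by (simp add: cidx_add_n cidx_id)
  obtain p r c where pr: "e + n = p + r" "c \<noteq> 0"
    and no: "\<And>j. 1 \<le> j \<Longrightarrow> j \<le> r \<Longrightarrow> cidx n (p + j) \<notin> exc_set n \<alpha>"
    and F: "\<And>\<sigma>. ract (seg (N \<sigma>) e n) (xnum (\<alpha> e)) =
          of_real (c * (\<Prod>j\<in>{j \<in> {e + 1..e + n}. cidx n j \<in> exc_set n \<alpha>}. exc_fun n \<alpha> ell (cidx n j) \<sigma>))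
            * ract (seg (N \<sigma>) p r) (xnum (\<alpha> (cidx n p)))"
    using seg_factor[OF e order_refl] unfolding N_def by blast
  \<comment> \<open>The walk ends at \<open>e + n\<close>, which is exceptional, so no arcs remain
    after the last exceptional vertex.\<close>
  have "r = 0"
  proof (rule ccontr)
    assume "r \<noteq> 0"
    then have "cidx n (p + r) \<notin> exc_set n \<alpha>" using no[of r] by simp
    then show False using e ce pr(1) by simp
  qed
  have bij: "(\<Prod>j\<in>{j \<in> {e + 1..e + n}. cidx n j \<in> exc_set n \<alpha>}. exc_fun n \<alpha> ell (cidx n j) \<sigma>)
      = (\<Prod>e\<in>exc_set n \<alpha>. exc_fun n \<alpha> ell e \<sigma>)" for \<sigma>
    by (rule prod.reindex_bij_betw[OF bij_betw_cidx[OF n en]]) (auto simp: exc_set_def)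
  have tr: "rtr (seg (N \<sigma>) e n) = c * (\<Prod>e\<in>exc_set n \<alpha>. exc_fun n \<alpha> ell e \<sigma>)" for \<sigma>
  proof -
    obtain m where m: "n = Suc m" using n by (cases n) auto
    have "e + Suc m = e + n" using m by simp
    then have "seg (N \<sigma>) e n = N \<sigma> (e + n) \<star> seg (N \<sigma>) e m" unfolding m seg.simps by simp
    also have "\<dots> = rN (\<alpha> e) \<star> (rB (ell e) \<sigma> \<star> seg (N \<sigma>) e m)"
      by (simp only: N_def ce rcomp_assoc)
    finally have "seg (N \<sigma>) e n = rN (\<alpha> e) \<star> (rB (ell e) \<sigma> \<star> seg (N \<sigma>) e m)" .
    from ract_rN_rcomp_exceptional[OF exc, of "rB (ell e) \<sigma> \<star> seg (N \<sigma>) e m", folded this]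
    have "of_real (rtr (seg (N \<sigma>) e n)) * xnum (\<alpha> e)
      = of_real (c * (\<Prod>e\<in>exc_set n \<alpha>. exc_fun n \<alpha> ell e \<sigma>)) * xnum (\<alpha> e)"
      using F[of \<sigma>] pr(1) ce unfolding \<open>r = 0\<close> bij by simp
    then show ?thesis by (simp only: mult_cancel_right xnum_nonzero of_real_eq_iff) simp
  qed
  \<comment> \<open>The product is cut at \<open>e\<close>, the pieces are swapped under the trace,
    and the indices of the first piece are shifted by \<open>n\<close>, so that the turn starts
    after \<open>e\<close>.\<close>
  have "rtr (seg (\<lambda>j. rN (\<alpha> j) \<star> rB (ell j) \<sigma>) 0 n) = rtr (seg (N \<sigma>) e n)" for \<sigma>
  proof -
    have "seg (\<lambda>j. rN (\<alpha> j) \<star> rB (ell j) \<sigma>) 0 n = seg (N \<sigma>) 0 n"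
      by (rule seg_cong) (simp add: N_def cidx_id)
    also have "\<dots> = seg (N \<sigma>) e (n - e) \<star> seg (N \<sigma>) 0 e"
      using seg_add[of "N \<sigma>" 0 e "n - e"] en by simp
    finally have "rtr (seg (\<lambda>j. rN (\<alpha> j) \<star> rB (ell j) \<sigma>) 0 n) = rtr (seg (N \<sigma>) 0 e \<star> seg (N \<sigma>) e (n - e))"
      by (simp only: rtr_commute)
    also have "seg (N \<sigma>) 0 e = seg (N \<sigma>) n e"
      by (rule seg_cong) (simp add: N_def cidx_add_n add.commute[of n])
    also have "seg (N \<sigma>) n e \<star> seg (N \<sigma>) e (n - e) = seg (N \<sigma>) e n"
      using seg_add[of "N \<sigma>" e "n - e" e] en by simp
    finally show ?thesis .
  qed
  moreover have "(\<Prod>j=1..n. sin (pi\<^sup>2 / (2 * \<alpha> j))) = 0"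
    using en sin_eq_0_iff_exceptional[OF \<alpha>[OF en]] exc by (intro prod_zero) auto
  ultimately have "FP n \<alpha> ell \<sigma> = (c / 2) * (\<Prod>e\<in>exc_set n \<alpha>. exc_fun n \<alpha> ell e \<sigma>)" for \<sigma>
    unfolding FP_eq_rtr[OF n] by (simp add: tr)
  then have "FP n \<alpha> ell = (\<lambda>\<sigma>. (c / 2) * (\<Prod>e\<in>exc_set n \<alpha>. exc_fun n \<alpha> ell e \<sigma>))"
    by (rule ext)
  then show ?thesis using pr(2) by (intro exI[of _ "c / 2"]) simp
qed

section \<open>The two cases of the theorem\<close>

lemma exceptional_case:
  assumes E: "exc_set n \<alpha> \<noteq> {}"
  shows "FP n \<alpha> ell \<sigma> = 0 \<longleftrightarrow> good_exc n \<alpha> ell \<sigma> \<noteq> {}"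
    and "root_mult (FP n \<alpha> ell) \<sigma> = card (good_exc n \<alpha> ell \<sigma>)"
    and "good_exc n \<alpha> ell 0 = {e \<in> exc_set n \<alpha>. parity_O (\<alpha> (prev_exc n \<alpha> e)) \<noteq> parity_O (\<alpha> e)}"
proof -
  obtain c where c: "c \<noteq> 0" "FP n \<alpha> ell = (\<lambda>\<sigma>. c * (\<Prod>e\<in>exc_set n \<alpha>. exc_fun n \<alpha> ell e \<sigma>))"
    using FP_factor[OF E] by blast
  have fin: "finite (exc_set n \<alpha>)" by (simp add: exc_set_def)
  show "FP n \<alpha> ell \<sigma> = 0 \<longleftrightarrow> good_exc n \<alpha> ell \<sigma> \<noteq> {}"
    using c(1) fin by (auto simp: c(2) good_exc_eq[OF n])
  show "root_mult (FP n \<alpha> ell) \<sigma> = card (good_exc n \<alpha> ell \<sigma>)"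
    unfolding c(2) good_exc_eq[OF n]
    using fin smooth_exc_fun deriv_exc_fun c(1) by (intro root_mult_prod) auto
  show "good_exc n \<alpha> ell 0 = {e \<in> exc_set n \<alpha>. parity_O (\<alpha> (prev_exc n \<alpha> e)) \<noteq> parity_O (\<alpha> e)}"
    using exc_fun_0 by (auto simp: good_exc_eq[OF n])
qed

lemma nonexceptional_case:
  assumes E: "exc_set n \<alpha> = {}"
  shows "FP n \<alpha> ell \<sigma> = 0 \<longleftrightarrow> eigenvalue (matT n \<alpha> ell \<sigma>) 1"
    and "FP n \<alpha> ell \<sigma> = 0 \<Longrightarrow> root_mult (FP n \<alpha> ell) \<sigma> = dim_gen_eigenspace (matT n \<alpha> ell \<sigma>) 1 1"
    and "FP n \<alpha> ell 0 = 0 \<Longrightarrow> root_mult (FP n \<alpha> ell) 0 = 2"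
proof -
  have sin: "sin (pi\<^sup>2 / (2 * \<alpha> j)) \<noteq> 0" if "j \<in> {1..n}" for j
    using sin_eq_0_iff_exceptional[OF \<alpha>[OF that]] E that by (auto simp: exc_set_def)
  define C where "C = (\<Prod>j=1..n. sin (pi\<^sup>2 / (2 * \<alpha> j)))"
  have "C \<noteq> 0" unfolding C_def using sin by simp
  define T where "T \<sigma> = seg (\<lambda>j. rA (\<alpha> j) \<star> rB (ell j) \<sigma>) 0 n" for \<sigma>
  have matT: "matT n \<alpha> ell \<sigma> = rmat (T \<sigma>)" for \<sigma> by (simp only: matT_def Tprod_eq_rmat T_def)
  obtain h k where flow: "positive_flow T h k" "\<And>\<sigma>. cmod (k \<sigma>) < h \<sigma>"
    using ex_positive_flow_seg[of n \<alpha> ell, OF sin ell] n unfolding T_def by blast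
  then have det: "rdet (T \<sigma>) = 1" for \<sigma> by (simp add: positive_flow_def)
  have FP: "FP n \<alpha> ell = (\<lambda>\<sigma>. C * (rtr (T \<sigma>) / 2 - 1))"
  proof
    fix \<sigma>
    have "seg (\<lambda>j. rN (\<alpha> j) \<star> rB (ell j) \<sigma>) 0 n = seg (\<lambda>j. rN (\<alpha> (cidx n j)) \<star> rB (ell (cidx n j)) \<sigma>) 0 n"
      by (rule seg_cong) (simp add: cidx_id)
    also have "\<dots> = (\<Prod>j=1..n. sin (pi\<^sup>2 / (2 * \<alpha> (cidx n (0 + j))))) *\<^sub>R
        seg (\<lambda>j. rA (\<alpha> (cidx n j)) \<star> rB (ell (cidx n j)) \<sigma>) 0 n"
      using sin by (intro seg_rN_eq) (simp add: cidx_id)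
    also have "(\<Prod>j=1..n. sin (pi\<^sup>2 / (2 * \<alpha> (cidx n (0 + j))))) = C"
      unfolding C_def by (rule prod.cong) (simp_all add: cidx_id)
    also have "seg (\<lambda>j. rA (\<alpha> (cidx n j)) \<star> rB (ell (cidx n j)) \<sigma>) 0 n = T \<sigma>"
      unfolding T_def by (rule seg_cong) (simp add: cidx_id)
    finally show "FP n \<alpha> ell \<sigma> = C * (rtr (T \<sigma>) / 2 - 1)"
      unfolding FP_eq_rtr[OF n] C_def[symmetric] by (simp add: rtr_scaleR algebra_simps)
  qed
  have zero: "FP n \<alpha> ell \<sigma> = 0 \<longleftrightarrow> rtr (T \<sigma>) = 2" for \<sigma>
    using \<open>C \<noteq> 0\<close> by (auto simp: FP)
  show "FP n \<alpha> ell \<sigma> = 0 \<longleftrightarrow> eigenvalue (matT n \<alpha> ell \<sigma>) 1"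
    unfolding zero matT eigenvalue_rmat_one det by auto
  have mult: "root_mult (FP n \<alpha> ell) \<sigma> = (if T \<sigma> = (1, 0) then 2 else 1)" if "FP n \<alpha> ell \<sigma> = 0" for \<sigma>
    using that unfolding zero by (rule root_mult_rtr[OF flow FP \<open>C \<noteq> 0\<close>])
  show "root_mult (FP n \<alpha> ell) \<sigma> = dim_gen_eigenspace (matT n \<alpha> ell \<sigma>) 1 1" if "FP n \<alpha> ell \<sigma> = 0"
    unfolding matT mult[OF that] using that dim_gen_eigenspace_rmat_one[OF det] by (simp add: zero)
  \<comment> \<open>At 0 all factors have real first and imaginary second component, a form closed
    under products. Trace 2 then gives first component 1, and determinant 1 makes the second
    vanish.\<close>
  have real: "Im (fst (seg (\<lambda>j. rA (\<alpha> j) \<star> rB (ell j) 0) 0 m)) = 0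
      \<and> Re (snd (seg (\<lambda>j. rA (\<alpha> j) \<star> rB (ell j) 0) 0 m)) = 0" for m
  proof (induction m)
    case (Suc m)
    then show ?case
      by (cases "seg (\<lambda>j. rA (\<alpha> j) \<star> rB (ell j) 0) 0 m") (simp add: rA_def rB_def Let_def)
  qed simp
  show "root_mult (FP n \<alpha> ell) 0 = 2" if "FP n \<alpha> ell 0 = 0"
  proof -
    have "Re (fst (T 0)) = 1" "Im (fst (T 0)) = 0"
      using that real[of n] unfolding zero by (simp_all add: T_def rtr_def)
    then have "fst (T 0) = 1" by (simp add: complex_eq_iff)
    moreover from this have "snd (T 0) = 0" using det[of 0] by (simp add: rdet_def)
    ultimately have "T 0 = (1, 0)" by (simp add: prod_eq_iff)
    then show ?thesis using mult[OF that] by simp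
  qed
qed

end

theorem theorem2p11:
  fixes n :: nat and \<alpha> ell :: "nat \<Rightarrow> real"
  assumes "n \<ge> 1"
    and "\<And>j. j \<in> {1..n} \<Longrightarrow> 0 < \<alpha> j \<and> \<alpha> j < pi"
    and "\<And>j. j \<in> {1..n} \<Longrightarrow> 0 < ell j"
  shows "(\<forall>\<sigma>\<ge>0. quasi_eigenvalue n \<alpha> ell \<sigma> \<longleftrightarrow> FP n \<alpha> ell \<sigma> = 0)
       \<and> (\<forall>\<sigma>>0. quasi_eigenvalue n \<alpha> ell \<sigma> \<longrightarrow>
              qe_mult n \<alpha> ell \<sigma> = real (root_mult (FP n \<alpha> ell) \<sigma>))
       \<and> (quasi_eigenvalue n \<alpha> ell 0 \<longrightarrow>
              qe_mult n \<alpha> ell 0 = real (root_mult (FP n \<alpha> ell) 0) / 2)"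
proof -
  have \<alpha>: "\<And>j. j \<in> {1..n} \<Longrightarrow> 0 < \<alpha> j" using assms(2) by blast
  note non = nonexceptional_case[OF assms(1) \<alpha> assms(3)]
  note exc = exceptional_case[OF assms(1) \<alpha> assms(3)]
  show ?thesis
  proof (cases "exc_set n \<alpha> = {}")
    case True
    then show ?thesis using non[OF _ _ True] by (auto simp: quasi_eigenvalue_def qe_mult_def)
  next
    case False
    then show ?thesis using exc[OF _ _ False] by (auto simp: quasi_eigenvalue_def qe_mult_def)
  qed
qed

end
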